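(* Let $Q$ be an acyclic quiver and let $\mathbf{d}\in\mathbb{Z}_{\geq 0}^{Q_0}$ be such that $d_v=0$ for some vertex $v\in Q_0$. Let $\overline{Q}_0:=Q_0\setminus\{v\}$ and $\overline{\mathbf{d}}:=(d_i)_{i\in\overline{Q}_0}$. Let $\mathcal{A}:=\{\alpha\in Q_1 \mid t(\alpha)=v\}$ and $\mathcal{B}:=\{\beta\in Q_1 \mid s(\beta)=v\}$, so that $\mathcal{AB}=\{\alpha\beta \mid \alpha\in\mathcal{A},\ \beta\in\mathcal{B}\}$ is the set of paths of length two in $Q$ with middle vertex $v$. Regard $\mathcal{AB}$ as a set of arrows, with $\alpha\beta$ an arrow from $s(\alpha)$ to $t(\beta)$, and let $\overline{Q}_1:=(Q_1\cup\mathcal{AB})\setminus(\mathcal{A}\cup\mathcal{B})$, giving the quiver $\overline{Q}:=(\overline{Q}_0,\overline{Q}_1)$. Then $A_{Q,\mathbf{d}}\cong A_{\overline{Q},\overline{\mathbf{d}}}$ as $\mathbb{k}$-algebras. In particular, $[Q,\mathbf{d}]=[\overline{Q},\overline{\mathbf{d}}]$.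
   Context: Let $\mathbb{k}=\mathbb{F}_q$ be a finite field. A quiver $Q=(Q_0,Q_1)$ consists of a finite set $Q_0$ of vertices and a finite set $Q_1$ of arrows, each arrow $\alpha$ having a source $s(\alpha)$ and a target $t(\alpha)$ in $Q_0$; multiple arrows are allowed. $Q$ is acyclic if it has no oriented cycles. Paths are written left to right ($cp$ means first $c$, then $p$). For a vertex $i$, $P_Q(i)$ is the indecomposable projective representation of $Q$ over $\mathbb{k}$ at $i$: its space at vertex $j$ has as basis the set of all paths from $i$ to $j$ (including the constant path $e_i$ if $j=i$), and an arrow $\alpha:j\to k$ acts by $c\mapsto c\alpha$. For a summand vector $\mathbf{d}\in\mathbb{Z}_{\geq 0}^{Q_0}$, $P_{Q,\mathbf{d}}:=\bigoplus_{i\in Q_0}P_Q(i)^{d_i}$ and $A_{Q,\mathbf{d}}:=\operatorname{End}(P_{Q,\mathbf{d}})$ is its endomorphism algebra in the category of representations of $Q$ over $\mathbb{k}$ (the zero algebra if $P_{Q,\mathbf{d}}=0$). $\operatorname{rad}$ denotes the Jacobson radical. The count $[Q,\mathbf{d}]$ is the number of pairs $(x,y)\in\operatorname{rad}A_{Q,\mathbf{d}}\times\operatorname{rad}A_{Q,\mathbf{d}}$ with $xy=yx$; it equals $1$ when $\mathbf{d}=\mathbf{0}$ or $Q_0=\varnothing$. *)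

theory Defs
  imports "HOL-Algebra.Algebra" "Jordan_Normal_Form.Missing_VectorSpace"
    "Graph_Theory.Arc_Walk"
begin

text \<open>
  A quiver is a \<open>fin_digraph\<close>: \<open>verts\<close>, \<open>arcs\<close>, \<open>tail\<close> and \<open>head\<close> are vertices, arrows, source and
  target.  Paths are arc walks, i.e. lists of arrows read from left to right; the constant path
  at \<open>i\<close> is the empty list, viewed as a walk from \<open>i\<close> to \<open>i\<close>.
\<close>

definition quiver_paths :: "('v, 'a) pre_digraph \<Rightarrow> 'v \<Rightarrow> 'v \<Rightarrow> 'a list set" where
  "quiver_paths Q i j = {p. pre_digraph.awalk Q i p j}"

definition acyclic_quiver :: "('v, 'a) pre_digraph \<Rightarrow> bool" where
  "acyclic_quiver Q \<longleftrightarrow> \<not> (\<exists>p. pre_digraph.cycle Q p)"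


section \<open>Representations of quivers\<close>

record ('v, 'a, 'k, 'm) quiver_rep =
  rep_space :: "'v \<Rightarrow> ('k, 'm) module"
  rep_act :: "'a \<Rightarrow> 'm \<Rightarrow> 'm"

definition is_quiver_rep ::
    "('k, 'x) ring_scheme \<Rightarrow> ('v, 'a) pre_digraph \<Rightarrow> ('v, 'a, 'k, 'm) quiver_rep \<Rightarrow> bool" where
  "is_quiver_rep K Q V \<longleftrightarrow>
     (\<forall>i\<in>verts Q. vectorspace K (rep_space V i)) \<and>
     (\<forall>\<alpha>\<in>arcs Q. rep_act V \<alpha> \<in>
        module_hom K (rep_space V (tail Q \<alpha>)) (rep_space V (head Q \<alpha>)))"

text \<open>
  Morphisms are families of linear maps indexed by the vertices.  They are taken extensional, both
  in the vertex and in the vector, so that equality of morphisms is equality of HOL functions.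
\<close>

definition rep_hom ::
    "('k, 'x) ring_scheme \<Rightarrow> ('v, 'a) pre_digraph \<Rightarrow> ('v, 'a, 'k, 'm) quiver_rep \<Rightarrow>
     ('v, 'a, 'k, 'n) quiver_rep \<Rightarrow> ('v \<Rightarrow> 'm \<Rightarrow> 'n) set" where
  "rep_hom K Q V W =
    {f \<in> (\<Pi>\<^sub>E i\<in>verts Q. module_hom K (rep_space V i) (rep_space W i)
                       \<inter> extensional (carrier (rep_space V i))).
      \<forall>\<alpha>\<in>arcs Q. \<forall>x\<in>carrier (rep_space V (tail Q \<alpha>)).
        f (head Q \<alpha>) (rep_act V \<alpha> x) = rep_act W \<alpha> (f (tail Q \<alpha>) x)}"

text \<open>The \<open>K\<close>-algebra of endomorphisms of \<open>V\<close>; the product \<open>f \<otimes> g\<close> is the composite ``first \<open>g\<close>, then \<open>f\<close>''.\<close>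

definition rep_End ::
    "('k, 'x) ring_scheme \<Rightarrow> ('v, 'a) pre_digraph \<Rightarrow> ('v, 'a, 'k, 'm) quiver_rep \<Rightarrow>
     ('k, 'v \<Rightarrow> 'm \<Rightarrow> 'm) module" where
  "rep_End K Q V =
    \<lparr> carrier = rep_hom K Q V V,
      monoid.mult = (\<lambda>f g. \<lambda>i\<in>verts Q. \<lambda>x\<in>carrier (rep_space V i). f i (g i x)),
      one = (\<lambda>i\<in>verts Q. \<lambda>x\<in>carrier (rep_space V i). x),
      ring.zero = (\<lambda>i\<in>verts Q. \<lambda>x\<in>carrier (rep_space V i). \<zero>\<^bsub>rep_space V i\<^esub>),
      add = (\<lambda>f g. \<lambda>i\<in>verts Q. \<lambda>x\<in>carrier (rep_space V i). f i x \<oplus>\<^bsub>rep_space V i\<^esub> g i x),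
      smult = (\<lambda>c f. \<lambda>i\<in>verts Q. \<lambda>x\<in>carrier (rep_space V i). c \<odot>\<^bsub>rep_space V i\<^esub> f i x) \<rparr>"

text \<open>
  Direct sum of a family with a \<^emph>\<open>finite\<close> index set \<open>I\<close> (for infinite \<open>I\<close> this is the product).
  The multiplicative fields of the record play no role for a vector space and are left undefined.
\<close>

definition rep_dsum ::
    "'i set \<Rightarrow> ('i \<Rightarrow> ('v, 'a, 'k, 'm) quiver_rep) \<Rightarrow> ('v, 'a, 'k, 'i \<Rightarrow> 'm) quiver_rep" where
  "rep_dsum I V =
    \<lparr> rep_space = (\<lambda>j.
        \<lparr> carrier = (\<Pi>\<^sub>E s\<in>I. carrier (rep_space (V s) j)),
          monoid.mult = undefined,
          one = undefined,
          ring.zero = (\<lambda>s\<in>I. \<zero>\<^bsub>rep_space (V s) j\<^esub>),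
          add = (\<lambda>x y. \<lambda>s\<in>I. x s \<oplus>\<^bsub>rep_space (V s) j\<^esub> y s),
          smult = (\<lambda>c x. \<lambda>s\<in>I. c \<odot>\<^bsub>rep_space (V s) j\<^esub> x s) \<rparr>),
      rep_act = (\<lambda>\<alpha> x. \<lambda>s\<in>I. rep_act (V s) \<alpha> (x s)) \<rparr>"


section \<open>Projective representations and their endomorphism algebras\<close>

text \<open>The vector space with basis \<open>S\<close>: finitely supported functions \<open>S \<rightarrow> K\<close>, extended by zero.\<close>

definition free_space :: "('k, 'x) ring_scheme \<Rightarrow> 's set \<Rightarrow> ('k, 's \<Rightarrow> 'k) module" where
  "free_space K S =
    \<lparr> carrier = {x. (\<forall>s. x s \<in> carrier K) \<and> {s. x s \<noteq> \<zero>\<^bsub>K\<^esub>} \<subseteq> S \<and> finite {s. x s \<noteq> \<zero>\<^bsub>K\<^esub>}},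
      monoid.mult = undefined,
      one = undefined,
      ring.zero = (\<lambda>s. \<zero>\<^bsub>K\<^esub>),
      add = (\<lambda>x y s. x s \<oplus>\<^bsub>K\<^esub> y s),
      smult = (\<lambda>c x s. c \<otimes>\<^bsub>K\<^esub> x s) \<rparr>"

definition basis_vec :: "('k, 'x) ring_scheme \<Rightarrow> 's \<Rightarrow> 's \<Rightarrow> 'k" where
  "basis_vec K s = (\<lambda>t. if t = s then \<one>\<^bsub>K\<^esub> else \<zero>\<^bsub>K\<^esub>)"

text \<open>
  The action of an arrow \<open>\<alpha>\<close> on the projective representation at \<open>i\<close> is the linear extension of
  \<open>c \<mapsto> c\<alpha>\<close> (see \<open>proj_rep_act_basis_vec\<close>): the coefficient of a path \<open>p\<close> in the image of \<open>x\<close> is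
  the coefficient of \<open>c\<close> in \<open>x\<close> if \<open>p = c\<alpha>\<close>, and zero if \<open>p\<close> does not end in \<open>\<alpha>\<close>.
\<close>

definition proj_rep ::
    "('k, 'x) ring_scheme \<Rightarrow> ('v, 'a) pre_digraph \<Rightarrow> 'v \<Rightarrow>
     ('v, 'a, 'k, 'a list \<Rightarrow> 'k) quiver_rep" where
  "proj_rep K Q i =
    \<lparr> rep_space = (\<lambda>j. free_space K (quiver_paths Q i j)),
      rep_act = (\<lambda>\<alpha> x p. if p \<noteq> [] \<and> last p = \<alpha> then x (butlast p) else \<zero>\<^bsub>K\<^esub>) \<rparr>"

lemma proj_rep_act_basis_vec:
  "rep_act (proj_rep K Q i) \<alpha> (basis_vec K c) = basis_vec K (c @ [\<alpha>])"
  by (auto simp: proj_rep_def basis_vec_def fun_eq_iff)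

definition proj_sum ::
    "('k, 'x) ring_scheme \<Rightarrow> ('v, 'a) pre_digraph \<Rightarrow> ('v \<Rightarrow> nat) \<Rightarrow>
     ('v, 'a, 'k, 'v \<times> nat \<Rightarrow> 'a list \<Rightarrow> 'k) quiver_rep" where
  "proj_sum K Q d = rep_dsum (SIGMA i:verts Q. {..<d i}) (\<lambda>(i, r). proj_rep K Q i)"

definition proj_End ::
    "('k, 'x) ring_scheme \<Rightarrow> ('v, 'a) pre_digraph \<Rightarrow> ('v \<Rightarrow> nat) \<Rightarrow>
     ('k, 'v \<Rightarrow> ('v \<times> nat \<Rightarrow> 'a list \<Rightarrow> 'k) \<Rightarrow> ('v \<times> nat \<Rightarrow> 'a list \<Rightarrow> 'k)) module" where
  "proj_End K Q d = rep_End K Q (proj_sum K Q d)"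


section \<open>Algebra isomorphisms, Jacobson radical, and the count of commuting pairs\<close>

definition algebra_iso ::
    "('k, 'x) ring_scheme \<Rightarrow> ('k, 'm, 'y) module_scheme \<Rightarrow> ('k, 'n, 'z) module_scheme \<Rightarrow>
     ('m \<Rightarrow> 'n) set" where
  "algebra_iso K A B = ring_iso A B \<inter> module_hom K A B"

definition algebra_isomorphic ::
    "('k, 'x) ring_scheme \<Rightarrow> ('k, 'm, 'y) module_scheme \<Rightarrow> ('k, 'n, 'z) module_scheme \<Rightarrow> bool" where
  "algebra_isomorphic K A B \<longleftrightarrow> algebra_iso K A B \<noteq> {}"

text \<open>\<open>HOL-Algebra.Ideal\<close> only has two-sided ideals.\<close>

definition left_ideal :: "('r, 'x) ring_scheme \<Rightarrow> 'r set \<Rightarrow> bool" where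
  "left_ideal R I \<longleftrightarrow> additive_subgroup I R \<and> (\<forall>a\<in>carrier R. \<forall>x\<in>I. a \<otimes>\<^bsub>R\<^esub> x \<in> I)"

definition maximal_left_ideal :: "('r, 'x) ring_scheme \<Rightarrow> 'r set \<Rightarrow> bool" where
  "maximal_left_ideal R I \<longleftrightarrow> left_ideal R I \<and> I \<noteq> carrier R \<and>
     (\<forall>J. left_ideal R J \<and> I \<subseteq> J \<longrightarrow> J = I \<or> J = carrier R)"

definition jacobson_radical :: "('r, 'x) ring_scheme \<Rightarrow> 'r set" where
  "jacobson_radical R = {x \<in> carrier R. \<forall>I. maximal_left_ideal R I \<longrightarrow> x \<in> I}"

definition commuting_count ::
    "('k, 'x) ring_scheme \<Rightarrow> ('v, 'a) pre_digraph \<Rightarrow> ('v \<Rightarrow> nat) \<Rightarrow> nat" where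
  "commuting_count K Q d =
    card {(x, y). x \<in> jacobson_radical (proj_End K Q d) \<and> y \<in> jacobson_radical (proj_End K Q d) \<and>
                  x \<otimes>\<^bsub>proj_End K Q d\<^esub> y = y \<otimes>\<^bsub>proj_End K Q d\<^esub> x}"


section \<open>Removing a vertex from a quiver\<close>

definition arrows_into :: "('v, 'a) pre_digraph \<Rightarrow> 'v \<Rightarrow> 'a set" where
  "arrows_into Q v = {\<alpha> \<in> arcs Q. head Q \<alpha> = v}"

definition arrows_from :: "('v, 'a) pre_digraph \<Rightarrow> 'v \<Rightarrow> 'a set" where
  "arrows_from Q v = {\<beta> \<in> arcs Q. tail Q \<beta> = v}"

text \<open>
  The arrows of the new quiver are paths of \<open>Q\<close>: an arrow \<open>\<gamma>\<close> of \<open>Q\<close> is identified with the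
  path \<open>[\<gamma>]\<close> of length one, and the new arrows are the paths \<open>[\<alpha>, \<beta>]\<close> of length two through \<open>v\<close>.
\<close>

definition remove_vertex :: "('v, 'a) pre_digraph \<Rightarrow> 'v \<Rightarrow> ('v, 'a list) pre_digraph" where
  "remove_vertex Q v =
    \<lparr> verts = verts Q - {v},
      arcs = ({[\<gamma>] |\<gamma>. \<gamma> \<in> arcs Q} \<union> {[\<alpha>, \<beta>] |\<alpha> \<beta>. \<alpha> \<in> arrows_into Q v \<and> \<beta> \<in> arrows_from Q v})
             - {[\<gamma>] |\<gamma>. \<gamma> \<in> arrows_into Q v \<union> arrows_from Q v},
      tail = (\<lambda>p. tail Q (hd p)),
      head = (\<lambda>p. head Q (last p)) \<rparr>"

end

theory Submission
  imports Defs
begin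

text \<open>
  No summand of the projective representation starts at \<open>v\<close>, so its space at \<open>v\<close> is the direct
  sum of copies of its spaces at the sources of the arrows into \<open>v\<close>.  An endomorphism is therefore
  determined by its components at the other vertices, and a family of such components extends to
  \<open>v\<close> as soon as it commutes with the remaining arrows and with the paths \<open>\<alpha>\<beta>\<close> through \<open>v\<close>.  As
  paths of the new quiver between vertices other than \<open>v\<close> are the same as paths of \<open>Q\<close>, these
  families are the endomorphisms of the projective representation of the new quiver.  A ring
  isomorphism carries maximal left ideals to maximal left ideals, which gives the equality of counts.
\<close>


section \<open>Module homomorphisms\<close>

text \<open>The delicate point is an arrow \<beta> out of \<open>v\<close>. The component at
  \<open>v\<close> is built from the arrows \<alpha> into \<open>v\<close> alone, and its
  compatibility with \<beta> is an equation between linear maps on the space at \<open>v\<close>. By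
  uniqueness this equation may be tested after each \<alpha>, where it becomes the relation for the
  arrow \<open>[\<alpha>, \<beta>]\<close> of the new quiver. This is why the products
  \<alpha>\<beta> are the arrows to adjoin.

  The second obstacle is that a path of the new quiver is a list of lists of arrows. The dictionary
  is \<open>concat\<close>, inverted by cutting a path at every vertex other than \<open>v\<close>.
  Acyclicity enters by excluding loops: with a loop at \<open>v\<close> a path could stay at
  \<open>v\<close> for several steps, so that words of length one and two would not suffice, and
  some new arrows would start or end at \<open>v\<close>.\<close>

lemma module_homI:
  assumes "\<And>x. x \<in> carrier M \<Longrightarrow> f x \<in> carrier N"
    and "\<And>x y. x \<in> carrier M \<Longrightarrow> y \<in> carrier M \<Longrightarrow> f (x \<oplus>\<^bsub>M\<^esub> y) = f x \<oplus>\<^bsub>N\<^esub> f y"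
    and "\<And>c x. c \<in> carrier K \<Longrightarrow> x \<in> carrier M \<Longrightarrow> f (c \<odot>\<^bsub>M\<^esub> x) = c \<odot>\<^bsub>N\<^esub> f x"
  shows "f \<in> module_hom K M N"
  using assms by (auto simp: module_hom_def)

lemma module_hom_mem: "f \<in> module_hom K M N \<Longrightarrow> x \<in> carrier M \<Longrightarrow> f x \<in> carrier N"
  by (auto simp: module_hom_def)

lemma module_hom_zero:
  assumes "module K M" "module K N" "f \<in> module_hom K M N"
  shows "f \<zero>\<^bsub>M\<^esub> = \<zero>\<^bsub>N\<^esub>"
  using assms by (intro mod_hom.f0_is_0[of K]) (simp add: mod_hom_def mod_hom_axioms_def)

text \<open>Agreement on the carrier suffices because a module is closed under its operations. This
  lets a linear map be replaced by its extensional truncation.\<close>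

lemma module_hom_cong:
  assumes "module K M" "f \<in> module_hom K M N" "\<And>x. x \<in> carrier M \<Longrightarrow> f x = g x"
  shows "g \<in> module_hom K M N"
proof -
  interpret module K M by fact
  show ?thesis
    using assms(2,3) by (auto simp: module_hom_def Pi_iff)
qed

lemma module_hom_comp:
  assumes "f \<in> module_hom K M N" "g \<in> module_hom K N P"
  shows "(\<lambda>x. g (f x)) \<in> module_hom K M P"
  using assms by (auto simp: module_hom_def Pi_iff)

lemma module_hom_id: "(\<lambda>x. x) \<in> module_hom K M M"
  by (auto simp: module_hom_def)

lemma module_hom_zero_map:
  assumes "module K N"
  shows "(\<lambda>x. \<zero>\<^bsub>N\<^esub>) \<in> module_hom K M N"
proof -
  interpret module K N by fact
  show ?thesis by (rule module_homI) auto
qed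

lemma module_hom_plus:
  assumes "module K N" "f \<in> module_hom K M N" "g \<in> module_hom K M N"
  shows "(\<lambda>x. f x \<oplus>\<^bsub>N\<^esub> g x) \<in> module_hom K M N"
proof -
  interpret module K N by fact
  note mem = module_hom_mem[OF assms(2)] module_hom_mem[OF assms(3)]
  show ?thesis
    by (rule module_homI)
      (simp_all add: mem module_hom_add[OF assms(2)] module_hom_add[OF assms(3)]
        module_hom_smult[OF assms(2)] module_hom_smult[OF assms(3)] smult_r_distr M.add.m_ac)
qed

lemma module_hom_scale:
  assumes "module K N" "f \<in> module_hom K M N" "c \<in> carrier K"
  shows "(\<lambda>x. c \<odot>\<^bsub>N\<^esub> f x) \<in> module_hom K M N"
proof -
  interpret module K N by fact
  note mem = module_hom_mem[OF assms(2)]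
  have "c \<odot>\<^bsub>N\<^esub> (r \<odot>\<^bsub>N\<^esub> y) = r \<odot>\<^bsub>N\<^esub> (c \<odot>\<^bsub>N\<^esub> y)"
    if "r \<in> carrier K" "y \<in> carrier N" for r y
    using that assms(3) by (simp flip: smult_assoc1 add: R.m_comm)
  then show ?thesis
    by (intro module_homI)
      (simp_all add: mem module_hom_add[OF assms(2)] module_hom_smult[OF assms(2)]
        assms(3) smult_r_distr)
qed

lemma module_hom_inv_into:
  assumes "module K M" "f \<in> module_hom K M N" "bij_betw f (carrier M) (carrier N)"
  shows "inv_into (carrier M) f \<in> module_hom K N M"
proof -
  interpret module K M by fact
  let ?g = "inv_into (carrier M) f"
  have g: "?g y \<in> carrier M" "f (?g y) = y" if "y \<in> carrier N" for y
    using that assms(3) bij_betw_inv_into_right[OF assms(3)] bij_betwE[OF bij_betw_inv_into[OF assms(3)]]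
    by auto
  have gf: "?g (f x) = x" if "x \<in> carrier M" for x
    using that bij_betw_inv_into_left[OF assms(3)] by auto
  show ?thesis
  proof (rule module_homI)
    fix x y assume xy: "x \<in> carrier N" "y \<in> carrier N"
    have "x \<oplus>\<^bsub>N\<^esub> y = f (?g x \<oplus>\<^bsub>M\<^esub> ?g y)"
      using xy g by (simp add: module_hom_add[OF assms(2)])
    then show "?g (x \<oplus>\<^bsub>N\<^esub> y) = ?g x \<oplus>\<^bsub>M\<^esub> ?g y"
      using xy g gf by simp
  next
    fix c y assume cy: "c \<in> carrier K" "y \<in> carrier N"
    have "c \<odot>\<^bsub>N\<^esub> y = f (c \<odot>\<^bsub>M\<^esub> ?g y)"
      using cy g by (simp add: module_hom_smult[OF assms(2)])
    then show "?g (c \<odot>\<^bsub>N\<^esub> y) = c \<odot>\<^bsub>M\<^esub> ?g y"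
      using cy g gf by simp
  qed (use g in auto)
qed


section \<open>Endomorphism algebras of representations\<close>

lemma is_quiver_rep_space: "is_quiver_rep K Q V \<Longrightarrow> i \<in> verts Q \<Longrightarrow> module K (rep_space V i)"
  by (auto simp: is_quiver_rep_def vectorspace_def)

lemma is_quiver_rep_act:
  "is_quiver_rep K Q V \<Longrightarrow> \<alpha> \<in> arcs Q \<Longrightarrow>
   rep_act V \<alpha> \<in> module_hom K (rep_space V (tail Q \<alpha>)) (rep_space V (head Q \<alpha>))"
  by (auto simp: is_quiver_rep_def)

lemma is_quiver_rep_act_mem:
  "is_quiver_rep K Q V \<Longrightarrow> \<alpha> \<in> arcs Q \<Longrightarrow> x \<in> carrier (rep_space V (tail Q \<alpha>)) \<Longrightarrow>
   rep_act V \<alpha> x \<in> carrier (rep_space V (head Q \<alpha>))"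
  using is_quiver_rep_act module_hom_mem by metis

text \<open>Morphisms are built from untruncated maps. As the arrows of \<open>V\<close> preserve
  carriers, the truncation is invisible in the naturality equation.\<close>

lemma rep_hom_restrictI:
  assumes "wf_digraph Q" "is_quiver_rep K Q V"
    and "\<And>i. i \<in> verts Q \<Longrightarrow> g i \<in> module_hom K (rep_space V i) (rep_space W i)"
    and "\<And>\<alpha> x. \<alpha> \<in> arcs Q \<Longrightarrow> x \<in> carrier (rep_space V (tail Q \<alpha>)) \<Longrightarrow>
      g (head Q \<alpha>) (rep_act V \<alpha> x) = rep_act W \<alpha> (g (tail Q \<alpha>) x)"
  shows "(\<lambda>i\<in>verts Q. \<lambda>x\<in>carrier (rep_space V i). g i x) \<in> rep_hom K Q V W"
proof -
  interpret wf_digraph Q by fact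
  have "(\<lambda>x\<in>carrier (rep_space V i). g i x) \<in> module_hom K (rep_space V i) (rep_space W i)"
    if "i \<in> verts Q" for i
    by (rule module_hom_cong[OF is_quiver_rep_space[OF assms(2) that] assms(3)[OF that]]) simp
  then show ?thesis
    using assms(4) by (auto simp: rep_hom_def is_quiver_rep_act_mem[OF assms(2)])
qed

lemma rep_hom_component:
  "f \<in> rep_hom K Q V W \<Longrightarrow> i \<in> verts Q \<Longrightarrow> f i \<in> module_hom K (rep_space V i) (rep_space W i)"
  by (auto simp: rep_hom_def PiE_iff)

lemma rep_hom_mem:
  "f \<in> rep_hom K Q V W \<Longrightarrow> i \<in> verts Q \<Longrightarrow> x \<in> carrier (rep_space V i) \<Longrightarrow>
   f i x \<in> carrier (rep_space W i)"
  using rep_hom_component module_hom_mem by metis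

lemma rep_hom_natural:
  "f \<in> rep_hom K Q V W \<Longrightarrow> \<alpha> \<in> arcs Q \<Longrightarrow> x \<in> carrier (rep_space V (tail Q \<alpha>)) \<Longrightarrow>
   f (head Q \<alpha>) (rep_act V \<alpha> x) = rep_act W \<alpha> (f (tail Q \<alpha>) x)"
  by (auto simp: rep_hom_def)

lemma rep_hom_eqI:
  assumes "f \<in> rep_hom K Q V W" "g \<in> rep_hom K Q V W"
    and "\<And>i x. i \<in> verts Q \<Longrightarrow> x \<in> carrier (rep_space V i) \<Longrightarrow> f i x = g i x"
  shows "f = g"
proof (rule PiE_ext)
  show "f \<in> (\<Pi>\<^sub>E i\<in>verts Q. extensional (carrier (rep_space V i)))"
    "g \<in> (\<Pi>\<^sub>E i\<in>verts Q. extensional (carrier (rep_space V i)))"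
    using assms(1,2) by (auto simp: rep_hom_def PiE_iff)
  fix i assume i: "i \<in> verts Q"
  with assms(1,2) have "f i \<in> extensional (carrier (rep_space V i))"
    "g i \<in> extensional (carrier (rep_space V i))"
    by (auto simp: rep_hom_def PiE_iff)
  then show "f i = g i"
    by (rule extensionalityI) (rule assms(3)[OF i])
qed

lemma rep_End_simps:
  "carrier (rep_End K Q V) = rep_hom K Q V V"
  "f \<otimes>\<^bsub>rep_End K Q V\<^esub> g = (\<lambda>i\<in>verts Q. \<lambda>x\<in>carrier (rep_space V i). f i (g i x))"
  "\<one>\<^bsub>rep_End K Q V\<^esub> = (\<lambda>i\<in>verts Q. \<lambda>x\<in>carrier (rep_space V i). x)"
  "\<zero>\<^bsub>rep_End K Q V\<^esub> = (\<lambda>i\<in>verts Q. \<lambda>x\<in>carrier (rep_space V i). \<zero>\<^bsub>rep_space V i\<^esub>)"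
  "f \<oplus>\<^bsub>rep_End K Q V\<^esub> g = (\<lambda>i\<in>verts Q. \<lambda>x\<in>carrier (rep_space V i). f i x \<oplus>\<^bsub>rep_space V i\<^esub> g i x)"
  "c \<odot>\<^bsub>rep_End K Q V\<^esub> f = (\<lambda>i\<in>verts Q. \<lambda>x\<in>carrier (rep_space V i). c \<odot>\<^bsub>rep_space V i\<^esub> f i x)"
  by (simp_all add: rep_End_def)

lemma rep_End_apply:
  assumes "i \<in> verts Q" "x \<in> carrier (rep_space V i)"
  shows "(f \<otimes>\<^bsub>rep_End K Q V\<^esub> g) i x = f i (g i x)"
    and "\<one>\<^bsub>rep_End K Q V\<^esub> i x = x"
    and "\<zero>\<^bsub>rep_End K Q V\<^esub> i x = \<zero>\<^bsub>rep_space V i\<^esub>"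
    and "(f \<oplus>\<^bsub>rep_End K Q V\<^esub> g) i x = f i x \<oplus>\<^bsub>rep_space V i\<^esub> g i x"
    and "(c \<odot>\<^bsub>rep_End K Q V\<^esub> f) i x = c \<odot>\<^bsub>rep_space V i\<^esub> f i x"
  using assms by (simp_all add: rep_End_simps)

context
  fixes K :: "('k, 'x) ring_scheme" and Q :: "('v, 'a) pre_digraph"
    and V :: "('v, 'a, 'k, 'm) quiver_rep"
  assumes Q: "wf_digraph Q" and V: "is_quiver_rep K Q V"
begin

interpretation wf_digraph Q by (fact Q)

lemma rep_End_mult_closed:
  assumes f: "f \<in> rep_hom K Q V V" and g: "g \<in> rep_hom K Q V V"
  shows "f \<otimes>\<^bsub>rep_End K Q V\<^esub> g \<in> rep_hom K Q V V"
  unfolding rep_End_simps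
proof (rule rep_hom_restrictI[OF Q V])
  show "(\<lambda>x. f i (g i x)) \<in> module_hom K (rep_space V i) (rep_space V i)" if "i \<in> verts Q" for i
    by (rule module_hom_comp[OF rep_hom_component[OF g that] rep_hom_component[OF f that]])
qed (simp add: rep_hom_natural[OF f] rep_hom_natural[OF g] rep_hom_mem[OF g])

lemma rep_End_one_closed: "\<one>\<^bsub>rep_End K Q V\<^esub> \<in> rep_hom K Q V V"
  unfolding rep_End_simps by (rule rep_hom_restrictI[OF Q V]) (simp_all add: module_hom_id)

lemma rep_End_zero_closed: "\<zero>\<^bsub>rep_End K Q V\<^esub> \<in> rep_hom K Q V V"
  unfolding rep_End_simps
  by (rule rep_hom_restrictI[OF Q V])
    (simp_all add: is_quiver_rep_space[OF V] module_hom_zero_map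
      module_hom_zero[OF _ _ is_quiver_rep_act[OF V]])

lemma rep_End_add_closed:
  assumes f: "f \<in> rep_hom K Q V V" and g: "g \<in> rep_hom K Q V V"
  shows "f \<oplus>\<^bsub>rep_End K Q V\<^esub> g \<in> rep_hom K Q V V"
  unfolding rep_End_simps
proof (rule rep_hom_restrictI[OF Q V])
  show "(\<lambda>x. f i x \<oplus>\<^bsub>rep_space V i\<^esub> g i x) \<in> module_hom K (rep_space V i) (rep_space V i)"
    if "i \<in> verts Q" for i
    using that by (intro module_hom_plus is_quiver_rep_space[OF V] rep_hom_component[OF f] rep_hom_component[OF g])
qed (simp add: rep_hom_natural[OF f] rep_hom_natural[OF g] rep_hom_mem[OF f] rep_hom_mem[OF g]
    module_hom_add[OF is_quiver_rep_act[OF V]])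

lemma rep_End_smult_closed:
  assumes f: "f \<in> rep_hom K Q V V" and c: "c \<in> carrier K"
  shows "c \<odot>\<^bsub>rep_End K Q V\<^esub> f \<in> rep_hom K Q V V"
  unfolding rep_End_simps
proof (rule rep_hom_restrictI[OF Q V])
  show "(\<lambda>x. c \<odot>\<^bsub>rep_space V i\<^esub> f i x) \<in> module_hom K (rep_space V i) (rep_space V i)"
    if "i \<in> verts Q" for i
    using that by (intro module_hom_scale is_quiver_rep_space[OF V] rep_hom_component[OF f] c)
qed (simp add: rep_hom_natural[OF f] rep_hom_mem[OF f] c
    module_hom_smult[OF is_quiver_rep_act[OF V]])

lemmas rep_End_closed = rep_End_mult_closed rep_End_one_closed rep_End_zero_closed
  rep_End_add_closed rep_End_smult_closed

text \<open>Composition is additive in the left factor by the definition of the sum, and in the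
  right factor by linearity of the components.\<close>

lemma ring_rep_End:
  assumes "cring K"
  shows "ring (rep_End K Q V)"
proof -
  let ?A = "rep_End K Q V"
  have mod: "module K (rep_space V i)" if "i \<in> verts Q" for i
    using that by (rule is_quiver_rep_space[OF V])
  have gr: "abelian_group (rep_space V i)" if "i \<in> verts Q" for i
    using mod[OF that] by (simp add: module_def)
  have mon: "abelian_monoid (rep_space V i)" if "i \<in> verts Q" for i
    using gr[OF that] by (simp add: abelian_group_def)
  note ac = abelian_monoid.a_assoc[OF mon] abelian_monoid.a_comm[OF mon]
    abelian_monoid.l_zero[OF mon]
  have "abelian_group ?A"
  proof (rule abelian_groupI, unfold rep_End_simps(1))
    fix f assume f: "f \<in> rep_hom K Q V V"
    interpret cring K by fact
    \<comment> \<open>The negative is taken as the multiple by minus one, which is a morphism by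
      closure under scalars.\<close>
    let ?g = "(\<ominus>\<^bsub>K\<^esub> \<one>\<^bsub>K\<^esub>) \<odot>\<^bsub>?A\<^esub> f"
    have g: "?g \<in> rep_hom K Q V V"
      by (rule rep_End_smult_closed[OF f]) simp
    have "?g \<oplus>\<^bsub>?A\<^esub> f = \<zero>\<^bsub>?A\<^esub>"
    proof (rule rep_hom_eqI[of _ K Q V V])
      fix i x assume ix: "i \<in> verts Q" "x \<in> carrier (rep_space V i)"
      interpret M: module K "rep_space V i" by (rule mod[OF ix(1)])
      show "(?g \<oplus>\<^bsub>?A\<^esub> f) i x = \<zero>\<^bsub>?A\<^esub> i x"
        using ix rep_hom_mem[OF f ix]
        by (simp add: rep_End_apply M.smult_l_minus M.M.l_neg)
    qed (intro rep_End_closed f g)+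
    with g show "\<exists>g\<in>rep_hom K Q V V. g \<oplus>\<^bsub>?A\<^esub> f = \<zero>\<^bsub>?A\<^esub>" by blast
  qed (auto intro!: rep_End_closed rep_hom_eqI[of _ K Q V V] simp: rep_End_apply rep_hom_mem ac)
  moreover have "monoid ?A"
    by (rule monoidI, unfold rep_End_simps(1))
      (auto intro!: rep_End_closed rep_hom_eqI[of _ K Q V V] simp: rep_End_apply rep_hom_mem)
  ultimately show ?thesis
    by (rule ringI; unfold rep_End_simps(1); intro rep_hom_eqI[of _ K Q V V] rep_End_closed)
      (simp_all add: rep_End_apply rep_hom_mem rep_End_closed
        module_hom_add[OF rep_hom_component])
qed

end


section \<open>The Jacobson radical under isomorphisms\<close>

lemma ring_hom_ring_of_iso:
  "ring R \<Longrightarrow> ring S \<Longrightarrow> h \<in> ring_iso R S \<Longrightarrow> ring_hom_ring R S h"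
  by (simp add: ring_hom_ring_def ring_hom_ring_axioms_def ring_iso_def)

text \<open>Every element of \<open>S\<close> has a preimage under \<open>h\<close>, so a left
  multiple of \<open>h a\<close> is the image of a left multiple of \<open>a\<close>.\<close>

lemma left_ideal_image:
  assumes R: "ring R" and S: "ring S" and h: "h \<in> ring_iso R S" and I: "left_ideal R I"
  shows "left_ideal S (h ` I)"
proof -
  interpret ring_hom_ring R S h by (rule ring_hom_ring_of_iso[OF R S h])
  interpret I: additive_subgroup I R using I by (simp add: left_ideal_def)
  have "subgroup (h ` I) (add_monoid S)"
  proof
    show "h ` I \<subseteq> carrier (add_monoid S)" using I.a_Hcarr by (simp add: image_subset_iff)
    show "\<one>\<^bsub>add_monoid S\<^esub> \<in> h ` I" using imageI[OF I.zero_closed, of h] by simp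
  next
    fix x y assume "x \<in> h ` I" "y \<in> h ` I"
    then show "x \<otimes>\<^bsub>add_monoid S\<^esub> y \<in> h ` I"
      using I.a_Hcarr I.a_closed by (clarsimp simp flip: hom_add)
  next
    fix x assume "x \<in> h ` I"
    then obtain a where a: "a \<in> I" "x = h a" by blast
    then have "h (\<ominus>\<^bsub>R\<^esub> a) = \<ominus>\<^bsub>S\<^esub> x" using I.a_Hcarr by simp
    with a show "inv\<^bsub>add_monoid S\<^esub> x \<in> h ` I"
      using I.a_inv_closed by (metis a_inv_def imageI)
  qed
  moreover have "s \<otimes>\<^bsub>S\<^esub> y \<in> h ` I" if s: "s \<in> carrier S" and y: "y \<in> h ` I" for s y
  proof -
    from y obtain a where a: "a \<in> I" "y = h a" by blast
    from s h obtain r where r: "r \<in> carrier R" "s = h r"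
      by (auto simp: ring_iso_def bij_betw_def)
    have "h (r \<otimes>\<^bsub>R\<^esub> a) = s \<otimes>\<^bsub>S\<^esub> y" using a r I.a_Hcarr by simp
    moreover have "r \<otimes>\<^bsub>R\<^esub> a \<in> I" using I a r by (simp add: left_ideal_def)
    ultimately show ?thesis by (metis imageI)
  qed
  ultimately show ?thesis by (auto simp: left_ideal_def additive_subgroup_def)
qed

lemma maximal_left_ideal_image:
  assumes R: "ring R" and S: "ring S" and h: "h \<in> ring_iso R S" and I: "maximal_left_ideal R I"
  shows "maximal_left_ideal S (h ` I)"
proof -
  let ?g = "inv_into (carrier R) h"
  have bij: "bij_betw h (carrier R) (carrier S)" and inj: "inj_on h (carrier R)"
    and g: "?g \<in> ring_iso S R"
    using h ring_iso_set_sym[OF R h] by (auto simp: ring_iso_def bij_betw_def)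
  have left: "left_ideal R I" and proper: "I \<noteq> carrier R"
    and max: "\<And>J. left_ideal R J \<Longrightarrow> I \<subseteq> J \<Longrightarrow> J = I \<or> J = carrier R"
    using I by (auto simp: maximal_left_ideal_def)
  have sub: "I \<subseteq> carrier R"
    using left by (auto simp: left_ideal_def dest: additive_subgroup.a_Hcarr)
  have "h ` I \<noteq> carrier S"
    using proper sub bij inj by (metis bij_betw_imp_surj_on inj_on_image_eq_iff subset_refl)
  \<comment> \<open>\<open>J\<close> is pulled back along the inverse, where the maximality of
    \<open>I\<close> applies, and then pushed forward again.\<close>
  moreover have "J = h ` I \<or> J = carrier S" if J: "left_ideal S J" "h ` I \<subseteq> J" for J
  proof -
    have JS: "J \<subseteq> carrier S"
      using J by (auto simp: left_ideal_def dest: additive_subgroup.a_Hcarr)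
    have hg: "h ` ?g ` J = J"
      using JS bij by (metis bij_betw_imp_surj_on image_inv_into_cancel)
    have "?g ` h ` I = I"
      using sub inj by (simp add: inv_into_image_cancel)
    then have "I \<subseteq> ?g ` J" using J(2) by blast
    with max left_ideal_image[OF S R g J(1)] have "?g ` J = I \<or> ?g ` J = carrier R" by blast
    with hg bij show ?thesis by (auto simp: bij_betw_def)
  qed
  ultimately show ?thesis
    using left_ideal_image[OF R S h left] by (auto simp: maximal_left_ideal_def)
qed

text \<open>Membership of \<open>h x\<close> in a maximal left ideal of \<open>S\<close> is tested
  on the preimage of that ideal, which is maximal in \<open>R\<close> because the inverse of
  \<open>h\<close> is an isomorphism too.\<close>

lemma jacobson_radical_image_subset:
  assumes R: "ring R" and S: "ring S" and h: "h \<in> ring_iso R S"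
  shows "h ` jacobson_radical R \<subseteq> jacobson_radical S"
proof (rule image_subsetI)
  let ?g = "inv_into (carrier R) h"
  have bij: "bij_betw h (carrier R) (carrier S)" and g: "?g \<in> ring_iso S R"
    using h ring_iso_set_sym[OF R h] by (auto simp: ring_iso_def)
  fix x assume x: "x \<in> jacobson_radical R"
  have "h x \<in> I" if I: "maximal_left_ideal S I" for I
  proof -
    have "I \<subseteq> carrier S"
      using I by (auto simp: maximal_left_ideal_def left_ideal_def dest: additive_subgroup.a_Hcarr)
    then have "h ` ?g ` I = I"
      using bij by (metis bij_betw_imp_surj_on image_inv_into_cancel)
    moreover have "x \<in> ?g ` I"
      using x maximal_left_ideal_image[OF S R g I] by (auto simp: jacobson_radical_def)
    ultimately show ?thesis by blast
  qed
  moreover have "h x \<in> carrier S"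
    using x bij by (auto simp: jacobson_radical_def bij_betw_def)
  ultimately show "h x \<in> jacobson_radical S" by (simp add: jacobson_radical_def)
qed

text \<open>The missing inclusion is the known one for the inverse of \<open>h\<close>.\<close>

lemma jacobson_radical_image:
  assumes R: "ring R" and S: "ring S" and h: "h \<in> ring_iso R S"
  shows "h ` jacobson_radical R = jacobson_radical S"
proof
  show "h ` jacobson_radical R \<subseteq> jacobson_radical S"
    by (rule jacobson_radical_image_subset[OF assms])
  let ?g = "inv_into (carrier R) h"
  have bij: "bij_betw h (carrier R) (carrier S)" and g: "?g \<in> ring_iso S R"
    using h ring_iso_set_sym[OF R h] by (auto simp: ring_iso_def)
  have "jacobson_radical S \<subseteq> carrier S" by (auto simp: jacobson_radical_def)
  then have "h ` ?g ` jacobson_radical S = jacobson_radical S"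
    using bij by (metis bij_betw_imp_surj_on image_inv_into_cancel)
  moreover have "?g ` jacobson_radical S \<subseteq> jacobson_radical R"
    by (rule jacobson_radical_image_subset[OF S R g])
  ultimately show "jacobson_radical S \<subseteq> h ` jacobson_radical R" by blast
qed

text \<open>Pairs are mapped componentwise. Injectivity of \<open>h\<close> is what reflects
  commutation from \<open>S\<close> back to \<open>R\<close>.\<close>

lemma card_commuting_pairs_radical:
  assumes R: "ring R" and S: "ring S" and h: "h \<in> ring_iso R S"
  shows "card {(x, y). x \<in> jacobson_radical R \<and> y \<in> jacobson_radical R \<and>
            x \<otimes>\<^bsub>R\<^esub> y = y \<otimes>\<^bsub>R\<^esub> x} =
         card {(x, y). x \<in> jacobson_radical S \<and> y \<in> jacobson_radical S \<and>
            x \<otimes>\<^bsub>S\<^esub> y = y \<otimes>\<^bsub>S\<^esub> x}" (is "card ?A = card ?B")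
proof (rule bij_betw_same_card)
  interpret ring_hom_ring R S h by (rule ring_hom_ring_of_iso[OF R S h])
  have inj: "inj_on h (carrier R)" using h by (auto simp: ring_iso_def bij_betw_def)
  have sub: "x \<in> carrier R" if "x \<in> jacobson_radical R" for x
    using that by (auto simp: jacobson_radical_def)
  have img: "jacobson_radical S = h ` jacobson_radical R"
    using jacobson_radical_image[OF assms] by simp
  have comm: "h x \<otimes>\<^bsub>S\<^esub> h y = h y \<otimes>\<^bsub>S\<^esub> h x \<longleftrightarrow> x \<otimes>\<^bsub>R\<^esub> y = y \<otimes>\<^bsub>R\<^esub> x"
    if "x \<in> carrier R" "y \<in> carrier R" for x y
    using that inj by (simp flip: hom_mult add: inj_on_eq_iff)
  show "bij_betw (map_prod h h) ?A ?B"
    unfolding bij_betw_def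
  proof
    show "inj_on (map_prod h h) ?A"
      using sub inj by (auto simp: inj_on_def)
    show "map_prod h h ` ?A = ?B"
      unfolding img using sub comm by (fastforce simp: image_iff)
  qed
qed


section \<open>Projective representations\<close>

lemma free_space_simps:
  "x \<oplus>\<^bsub>free_space K S\<^esub> y = (\<lambda>s. x s \<oplus>\<^bsub>K\<^esub> y s)"
  "\<zero>\<^bsub>free_space K S\<^esub> = (\<lambda>s. \<zero>\<^bsub>K\<^esub>)"
  "c \<odot>\<^bsub>free_space K S\<^esub> x = (\<lambda>s. c \<otimes>\<^bsub>K\<^esub> x s)"
  by (simp_all add: free_space_def)

lemma free_space_memI:
  assumes "\<And>s. x s \<in> carrier K" "\<And>s. x s \<noteq> \<zero>\<^bsub>K\<^esub> \<Longrightarrow> s \<in> S" "finite {s. x s \<noteq> \<zero>\<^bsub>K\<^esub>}"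
  shows "x \<in> carrier (free_space K S)"
  using assms by (auto simp: free_space_def)

lemma free_space_memD:
  assumes "x \<in> carrier (free_space K S)"
  shows "x s \<in> carrier K" "x s \<noteq> \<zero>\<^bsub>K\<^esub> \<Longrightarrow> s \<in> S" "finite {s. x s \<noteq> \<zero>\<^bsub>K\<^esub>}"
  using assms by (auto simp: free_space_def)

lemma module_free_space:
  assumes "cring K"
  shows "module K (free_space K S)"
proof -
  interpret cring K by fact
  have plus: "(\<lambda>s. x s \<oplus>\<^bsub>K\<^esub> y s) \<in> carrier (free_space K S)"
    if xy: "x \<in> carrier (free_space K S)" "y \<in> carrier (free_space K S)" for x y
  proof (rule free_space_memI)
    have "{s. x s \<oplus>\<^bsub>K\<^esub> y s \<noteq> \<zero>\<^bsub>K\<^esub>} \<subseteq> {s. x s \<noteq> \<zero>\<^bsub>K\<^esub>} \<union> {s. y s \<noteq> \<zero>\<^bsub>K\<^esub>}" by auto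
    then show "finite {s. x s \<oplus>\<^bsub>K\<^esub> y s \<noteq> \<zero>\<^bsub>K\<^esub>}"
      using free_space_memD(3)[OF xy(1)] free_space_memD(3)[OF xy(2)]
      by (meson finite_UnI finite_subset)
    show "s \<in> S" if "x s \<oplus>\<^bsub>K\<^esub> y s \<noteq> \<zero>\<^bsub>K\<^esub>" for s
      using that free_space_memD(2)[OF xy(1), of s] free_space_memD(2)[OF xy(2), of s]
      by (cases "x s = \<zero>\<^bsub>K\<^esub>"; cases "y s = \<zero>\<^bsub>K\<^esub>") simp_all
  qed (simp add: free_space_memD(1)[OF xy(1)] free_space_memD(1)[OF xy(2)])
  have scale: "(\<lambda>s. c \<otimes>\<^bsub>K\<^esub> x s) \<in> carrier (free_space K S)"
    if c: "c \<in> carrier K" and x: "x \<in> carrier (free_space K S)" for c x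
  proof (rule free_space_memI)
    have "{s. c \<otimes>\<^bsub>K\<^esub> x s \<noteq> \<zero>\<^bsub>K\<^esub>} \<subseteq> {s. x s \<noteq> \<zero>\<^bsub>K\<^esub>}" using c by auto
    then show "finite {s. c \<otimes>\<^bsub>K\<^esub> x s \<noteq> \<zero>\<^bsub>K\<^esub>}"
      using free_space_memD(3)[OF x] by (rule finite_subset)
    show "s \<in> S" if "c \<otimes>\<^bsub>K\<^esub> x s \<noteq> \<zero>\<^bsub>K\<^esub>" for s
      using that c free_space_memD(2)[OF x, of s] by (cases "x s = \<zero>\<^bsub>K\<^esub>") simp_all
  qed (simp add: c free_space_memD(1)[OF x])
  show ?thesis
  proof (rule moduleI)
    show "abelian_group (free_space K S)"
    proof (rule abelian_groupI)
      show "\<zero>\<^bsub>free_space K S\<^esub> \<in> carrier (free_space K S)"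
        by (rule free_space_memI) (simp_all add: free_space_simps)
    next
      fix x assume x: "x \<in> carrier (free_space K S)"
      have "(\<lambda>s. \<ominus>\<^bsub>K\<^esub> \<one>\<^bsub>K\<^esub> \<otimes>\<^bsub>K\<^esub> x s) \<oplus>\<^bsub>free_space K S\<^esub> x = \<zero>\<^bsub>free_space K S\<^esub>"
        by (simp add: free_space_simps free_space_memD(1)[OF x] l_minus l_neg)
      moreover have "(\<lambda>s. \<ominus>\<^bsub>K\<^esub> \<one>\<^bsub>K\<^esub> \<otimes>\<^bsub>K\<^esub> x s) \<in> carrier (free_space K S)"
        by (rule scale[OF _ x]) simp
      ultimately show "\<exists>y\<in>carrier (free_space K S). y \<oplus>\<^bsub>free_space K S\<^esub> x = \<zero>\<^bsub>free_space K S\<^esub>"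
        by blast
    qed (simp_all add: free_space_simps plus free_space_memD(1) a_ac)
  qed (simp_all add: free_space_simps plus scale free_space_memD(1) assms m_assoc l_distr r_distr)
qed

lemma rep_dsum_simps:
  "carrier (rep_space (rep_dsum I V) j) = (\<Pi>\<^sub>E s\<in>I. carrier (rep_space (V s) j))"
  "\<zero>\<^bsub>rep_space (rep_dsum I V) j\<^esub> = (\<lambda>s\<in>I. \<zero>\<^bsub>rep_space (V s) j\<^esub>)"
  "x \<oplus>\<^bsub>rep_space (rep_dsum I V) j\<^esub> y = (\<lambda>s\<in>I. x s \<oplus>\<^bsub>rep_space (V s) j\<^esub> y s)"
  "c \<odot>\<^bsub>rep_space (rep_dsum I V) j\<^esub> x = (\<lambda>s\<in>I. c \<odot>\<^bsub>rep_space (V s) j\<^esub> x s)"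
  "rep_act (rep_dsum I V) \<alpha> x = (\<lambda>s\<in>I. rep_act (V s) \<alpha> (x s))"
  by (simp_all add: rep_dsum_def)

lemma module_rep_dsum:
  assumes K: "cring K" and V: "\<And>s. s \<in> I \<Longrightarrow> module K (rep_space (V s) j)"
  shows "module K (rep_space (rep_dsum I V) j)"
proof -
  interpret cring K by fact
  let ?M = "\<lambda>s. rep_space (V s) j" and ?D = "rep_space (rep_dsum I V) j"
  have gr: "abelian_group (?M s)" if "s \<in> I" for s
    using V[OF that] by (simp add: module_def)
  have mon: "abelian_monoid (?M s)" if "s \<in> I" for s
    using gr[OF that] by (simp add: abelian_group_def)
  have eqI: "x = y" if "x \<in> carrier ?D" "y \<in> carrier ?D" "\<And>s. s \<in> I \<Longrightarrow> x s = y s" for x y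
    using that by (auto simp: rep_dsum_simps intro: PiE_ext)
  have plus: "x \<oplus>\<^bsub>?D\<^esub> y \<in> carrier ?D" if "x \<in> carrier ?D" "y \<in> carrier ?D" for x y
    using that by (simp add: rep_dsum_simps PiE_iff abelian_monoid.a_closed[OF mon])
  have scale: "c \<odot>\<^bsub>?D\<^esub> x \<in> carrier ?D" if "c \<in> carrier K" "x \<in> carrier ?D" for c x
    using that by (simp add: rep_dsum_simps PiE_iff module.smult_closed[OF V])
  have zero: "\<zero>\<^bsub>?D\<^esub> \<in> carrier ?D"
    by (simp add: rep_dsum_simps PiE_iff abelian_monoid.zero_closed[OF mon])
  have apply_simps: "(x \<oplus>\<^bsub>?D\<^esub> y) s = x s \<oplus>\<^bsub>?M s\<^esub> y s" "(c \<odot>\<^bsub>?D\<^esub> x) s = c \<odot>\<^bsub>?M s\<^esub> x s"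
    "\<zero>\<^bsub>?D\<^esub> s = \<zero>\<^bsub>?M s\<^esub>" if "s \<in> I" for x y c s
    using that by (simp_all add: rep_dsum_simps)
  have mem: "x s \<in> carrier (?M s)" if "x \<in> carrier ?D" "s \<in> I" for x s
    using that by (auto simp: rep_dsum_simps)
  show ?thesis
  proof (rule moduleI)
    show "abelian_group ?D"
    proof (rule abelian_groupI)
      fix x assume x: "x \<in> carrier ?D"
      let ?y = "(\<ominus>\<^bsub>K\<^esub> \<one>\<^bsub>K\<^esub>) \<odot>\<^bsub>?D\<^esub> x"
      have y: "?y \<in> carrier ?D" by (rule scale[OF _ x]) simp
      have "?y \<oplus>\<^bsub>?D\<^esub> x = \<zero>\<^bsub>?D\<^esub>"
      proof (rule eqI[OF plus[OF y x] zero])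
        fix s assume s: "s \<in> I"
        interpret M: module K "?M s" by (rule V[OF s])
        show "(?y \<oplus>\<^bsub>?D\<^esub> x) s = \<zero>\<^bsub>?D\<^esub> s"
          using mem[OF x s] by (simp add: apply_simps[OF s] M.smult_l_minus M.M.l_neg)
      qed
      with y show "\<exists>y\<in>carrier ?D. y \<oplus>\<^bsub>?D\<^esub> x = \<zero>\<^bsub>?D\<^esub>" by blast
    qed (auto intro!: eqI plus zero simp: apply_simps mem abelian_monoid.a_assoc[OF mon]
        abelian_monoid.a_comm[OF mon] abelian_monoid.l_zero[OF mon])
  qed (auto intro!: eqI plus scale simp: K apply_simps mem module.smult_l_distr[OF V]
      module.smult_r_distr[OF V] module.smult_assoc1[OF V] module.smult_one[OF V])
qed

section \<open>Paths read from their last arrow, and coordinates on the projective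
  representations\<close>

lemma quiver_paths_Nil: "[] \<in> quiver_paths Q i j \<longleftrightarrow> i \<in> verts Q \<and> i = j"
  by (auto simp: quiver_paths_def pre_digraph.awalk_def pre_digraph.cas.simps)

text \<open>Walks are defined by recursion on their first arrow, whereas arrows act on projectives
  by appending at the end; this turns the recursion around.\<close>

lemma quiver_paths_snoc:
  assumes "wf_digraph Q"
  shows "p @ [\<alpha>] \<in> quiver_paths Q i j \<longleftrightarrow>
    p \<in> quiver_paths Q i (tail Q \<alpha>) \<and> \<alpha> \<in> arcs Q \<and> head Q \<alpha> = j"
proof -
  interpret wf_digraph Q by fact
  show ?thesis
    by (induction p arbitrary: i) (auto simp: quiver_paths_def awalk_simps)
qed

text \<open>Kept as a constant so that the index sets belonging to the two quivers can be identified
  by one equation, \<open>proj_index_remove_vertex\<close>.\<close>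

definition proj_index :: "('v, 'a) pre_digraph \<Rightarrow> ('v \<Rightarrow> nat) \<Rightarrow> ('v \<times> nat) set" where
  "proj_index Q d = (SIGMA i:verts Q. {..<d i})"

abbreviation proj_sum_space ::
    "('k, 'x) ring_scheme \<Rightarrow> ('v, 'a) pre_digraph \<Rightarrow> ('v \<Rightarrow> nat) \<Rightarrow> 'v \<Rightarrow>
     ('k, 'v \<times> nat \<Rightarrow> 'a list \<Rightarrow> 'k) module" where
  "proj_sum_space K Q d j \<equiv> rep_space (proj_sum K Q d) j"

text \<open>The coefficient \<open>x s p\<close> of the path \<open>p\<close> in the summand
  \<open>s\<close> serves as a coordinate. The summand depends on \<open>s\<close> through its
  vertex \<open>fst s\<close>; the second component numbers the copies.\<close>

lemma proj_sum_simps: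
  "carrier (proj_sum_space K Q d j) =
    (\<Pi>\<^sub>E s\<in>proj_index Q d. carrier (free_space K (quiver_paths Q (fst s) j)))"
  "\<zero>\<^bsub>proj_sum_space K Q d j\<^esub> = (\<lambda>s\<in>proj_index Q d. \<lambda>p. \<zero>\<^bsub>K\<^esub>)"
  "x \<oplus>\<^bsub>proj_sum_space K Q d j\<^esub> y = (\<lambda>s\<in>proj_index Q d. \<lambda>p. x s p \<oplus>\<^bsub>K\<^esub> y s p)"
  "c \<odot>\<^bsub>proj_sum_space K Q d j\<^esub> x = (\<lambda>s\<in>proj_index Q d. \<lambda>p. c \<otimes>\<^bsub>K\<^esub> x s p)"
  "rep_act (proj_sum K Q d) \<alpha> x =
    (\<lambda>s\<in>proj_index Q d. \<lambda>p. if p \<noteq> [] \<and> last p = \<alpha> then x s (butlast p) else \<zero>\<^bsub>K\<^esub>)"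
  by (auto simp: proj_sum_def rep_dsum_simps proj_rep_def proj_index_def free_space_simps
      split_beta intro!: PiE_cong restrict_ext)

lemma proj_sum_memI:
  assumes "\<And>s p. s \<in> proj_index Q d \<Longrightarrow> x s p \<in> carrier K"
    and "\<And>s p. s \<in> proj_index Q d \<Longrightarrow> x s p \<noteq> \<zero>\<^bsub>K\<^esub> \<Longrightarrow> p \<in> quiver_paths Q (fst s) j"
    and "\<And>s. s \<in> proj_index Q d \<Longrightarrow> finite {p. x s p \<noteq> \<zero>\<^bsub>K\<^esub>}"
    and "x \<in> extensional (proj_index Q d)"
  shows "x \<in> carrier (proj_sum_space K Q d j)"
  using assms unfolding proj_sum_simps PiE_iff by (blast intro: free_space_memI)

lemma proj_sum_memD:
  assumes "x \<in> carrier (proj_sum_space K Q d j)" and "s \<in> proj_index Q d"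
  shows "x s p \<in> carrier K"
    and "x s p \<noteq> \<zero>\<^bsub>K\<^esub> \<Longrightarrow> p \<in> quiver_paths Q (fst s) j"
    and "finite {p. x s p \<noteq> \<zero>\<^bsub>K\<^esub>}"
  using assms unfolding proj_sum_simps PiE_iff by (auto dest: free_space_memD)

lemma proj_sum_eqI:
  assumes "x \<in> extensional (proj_index Q d)" "y \<in> extensional (proj_index Q d)"
    and "\<And>s p. s \<in> proj_index Q d \<Longrightarrow> x s p = y s p"
  shows "x = y"
  by (rule extensionalityI[OF assms(1,2)]) (rule ext, rule assms(3))

lemma proj_sum_ext:
  "x \<in> carrier (proj_sum_space K Q d j) \<Longrightarrow> x \<in> extensional (proj_index Q d)"
  by (simp add: proj_sum_simps PiE_iff)

lemma proj_sum_act_mem: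
  assumes Q: "wf_digraph Q" and K: "cring K" and \<alpha>: "\<alpha> \<in> arcs Q"
    and x: "x \<in> carrier (proj_sum_space K Q d (tail Q \<alpha>))"
  shows "rep_act (proj_sum K Q d) \<alpha> x \<in> carrier (proj_sum_space K Q d (head Q \<alpha>))"
proof -
  interpret cring K by fact
  show ?thesis
  proof (rule proj_sum_memI)
    fix s p assume s: "s \<in> proj_index Q d" and "rep_act (proj_sum K Q d) \<alpha> x s p \<noteq> \<zero>\<^bsub>K\<^esub>"
    then have p: "p = butlast p @ [\<alpha>]" and nz: "x s (butlast p) \<noteq> \<zero>\<^bsub>K\<^esub>"
      by (auto simp: proj_sum_simps split: if_splits)
    have "butlast p @ [\<alpha>] \<in> quiver_paths Q (fst s) (head Q \<alpha>)"
      unfolding quiver_paths_snoc[OF Q] using \<alpha> proj_sum_memD(2)[OF x s nz] by simp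
    with p show "p \<in> quiver_paths Q (fst s) (head Q \<alpha>)" by simp
  next
    fix s assume s: "s \<in> proj_index Q d"
    \<comment> \<open>The action moves the support along the map that appends \<alpha>, so the
      support stays finite.\<close>
    have "{p. rep_act (proj_sum K Q d) \<alpha> x s p \<noteq> \<zero>\<^bsub>K\<^esub>} \<subseteq> (\<lambda>p. p @ [\<alpha>]) ` {p. x s p \<noteq> \<zero>\<^bsub>K\<^esub>}"
    proof
      fix p assume "p \<in> {p. rep_act (proj_sum K Q d) \<alpha> x s p \<noteq> \<zero>\<^bsub>K\<^esub>}"
      with s have "p = butlast p @ [\<alpha>]" "x s (butlast p) \<noteq> \<zero>\<^bsub>K\<^esub>"
        by (auto simp: proj_sum_simps split: if_splits)
      then show "p \<in> (\<lambda>p. p @ [\<alpha>]) ` {p. x s p \<noteq> \<zero>\<^bsub>K\<^esub>}" by blast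
    qed
    then show "finite {p. rep_act (proj_sum K Q d) \<alpha> x s p \<noteq> \<zero>\<^bsub>K\<^esub>}"
      using proj_sum_memD(3)[OF x s] by (meson finite_imageI finite_subset)
  qed (use proj_sum_memD(1)[OF x] in \<open>auto simp: proj_sum_simps\<close>)
qed

lemma is_quiver_rep_proj_sum:
  assumes Q: "wf_digraph Q" and K: "field K"
  shows "is_quiver_rep K Q (proj_sum K Q d)"
proof -
  interpret field K by fact
  have K': "cring K" ..
  have "vectorspace K (proj_sum_space K Q d j)" for j
    unfolding vectorspace_def proj_sum_def
    by (auto intro!: module_rep_dsum module_free_space K' K simp: proj_rep_def)
  moreover have "rep_act (proj_sum K Q d) \<alpha> \<in>
      module_hom K (proj_sum_space K Q d (tail Q \<alpha>)) (proj_sum_space K Q d (head Q \<alpha>))"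
    if "\<alpha> \<in> arcs Q" for \<alpha>
  proof (rule module_homI)
    show "rep_act (proj_sum K Q d) \<alpha> x \<in> carrier (proj_sum_space K Q d (head Q \<alpha>))"
      if "x \<in> carrier (proj_sum_space K Q d (tail Q \<alpha>))" for x
      using that by (rule proj_sum_act_mem[OF Q K' \<open>\<alpha> \<in> arcs Q\<close>])
  qed (auto simp: proj_sum_simps fun_eq_iff)
  ultimately show ?thesis by (simp add: is_quiver_rep_def)
qed


section \<open>The space at a vertex with zero multiplicity\<close>

text \<open>Selects the terms whose path ends in \<alpha> and strips that arrow: a left inverse of
  the action of \<alpha>, see \<open>arrow_part_act\<close>.\<close>

definition arrow_part ::
    "('v, 'a) pre_digraph \<Rightarrow> ('v \<Rightarrow> nat) \<Rightarrow> 'a \<Rightarrow> ('v \<times> nat \<Rightarrow> 'a list \<Rightarrow> 'k) \<Rightarrow>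
     'v \<times> nat \<Rightarrow> 'a list \<Rightarrow> 'k" where
  "arrow_part Q d \<alpha> x = (\<lambda>s\<in>proj_index Q d. \<lambda>p. x s (p @ [\<alpha>]))"

lemma arrow_part_hom:
  assumes Q: "wf_digraph Q" and \<alpha>: "\<alpha> \<in> arcs Q"
  shows "arrow_part Q d \<alpha> \<in>
    module_hom K (proj_sum_space K Q d (head Q \<alpha>)) (proj_sum_space K Q d (tail Q \<alpha>))"
proof (rule module_homI)
  fix x assume x: "x \<in> carrier (proj_sum_space K Q d (head Q \<alpha>))"
  show "arrow_part Q d \<alpha> x \<in> carrier (proj_sum_space K Q d (tail Q \<alpha>))"
  proof (rule proj_sum_memI)
    fix s p assume s: "s \<in> proj_index Q d" and "arrow_part Q d \<alpha> x s p \<noteq> \<zero>\<^bsub>K\<^esub>"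
    then have "p @ [\<alpha>] \<in> quiver_paths Q (fst s) (head Q \<alpha>)"
      by (intro proj_sum_memD(2)[OF x s]) (simp add: arrow_part_def)
    then show "p \<in> quiver_paths Q (fst s) (tail Q \<alpha>)"
      by (simp add: quiver_paths_snoc[OF Q])
  next
    fix s assume s: "s \<in> proj_index Q d"
    have "finite ((\<lambda>p. p @ [\<alpha>]) -` {p. x s p \<noteq> \<zero>\<^bsub>K\<^esub>})"
      using proj_sum_memD(3)[OF x s] by (rule finite_vimageI) (simp add: inj_on_def)
    then show "finite {p. arrow_part Q d \<alpha> x s p \<noteq> \<zero>\<^bsub>K\<^esub>}"
      using s by (simp add: arrow_part_def vimage_def)
  qed (use proj_sum_memD(1)[OF x] in \<open>simp_all add: arrow_part_def\<close>)
qed (auto simp: arrow_part_def proj_sum_simps fun_eq_iff)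

text \<open>A path has just one last arrow, so the images of distinct arrows are independent.
  Extensionality of \<open>x\<close> makes the result equal to \<open>x\<close> also outside the
  index set.\<close>

lemma arrow_part_act:
  assumes "x \<in> extensional (proj_index Q d)"
  shows "arrow_part Q d \<beta> (rep_act (proj_sum K Q d) \<alpha> x) =
    (if \<beta> = \<alpha> then x else (\<lambda>s\<in>proj_index Q d. \<lambda>p. \<zero>\<^bsub>K\<^esub>))"
  using assms by (auto simp: arrow_part_def proj_sum_simps fun_eq_iff extensional_def)

text \<open>A path to \<open>v\<close> without a last arrow is the constant path at
  \<open>v\<close>, which would require a summand starting there.\<close>

lemma path_to_removed_vertex:
  assumes Q: "wf_digraph Q" and d: "d v = 0"
    and s: "s \<in> proj_index Q d" and p: "p \<in> quiver_paths Q (fst s) v"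
  shows "p \<noteq> []" and "last p \<in> arrows_into Q v"
proof -
  show "p \<noteq> []"
    using d s p by (auto simp: proj_index_def quiver_paths_Nil)
  then have "butlast p @ [last p] \<in> quiver_paths Q (fst s) v" using p by simp
  then show "last p \<in> arrows_into Q v"
    unfolding quiver_paths_snoc[OF Q] by (simp add: arrows_into_def)
qed

text \<open>
  Since no summand starts at \<open>v\<close>, every path to \<open>v\<close> has a last arrow, so the space at \<open>v\<close> is the
  direct sum of the images of the arrows into \<open>v\<close>.  The next two lemmas are the uniqueness and the
  existence part of its universal property.
\<close>

lemma proj_sum_hom_eq:
  assumes Q: "fin_digraph Q" and K: "field K" and d: "d v = 0"
    and N: "module K N"
    and f: "f \<in> module_hom K (proj_sum_space K Q d v) N"
    and g: "g \<in> module_hom K (proj_sum_space K Q d v) N"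
    and fg: "\<And>\<alpha> y. \<alpha> \<in> arrows_into Q v \<Longrightarrow> y \<in> carrier (proj_sum_space K Q d (tail Q \<alpha>)) \<Longrightarrow>
      f (rep_act (proj_sum K Q d) \<alpha> y) = g (rep_act (proj_sum K Q d) \<alpha> y)"
    and x: "x \<in> carrier (proj_sum_space K Q d v)" and v: "v \<in> verts Q"
  shows "f x = g x"
proof -
  interpret fin_digraph Q by fact
  interpret K: field K by fact
  let ?V = "proj_sum K Q d" and ?I = "proj_index Q d"
  have Vrep: "is_quiver_rep K Q ?V" by (rule is_quiver_rep_proj_sum[OF wf_digraph K])
  have V: "module K (rep_space ?V v)" by (rule is_quiver_rep_space[OF Vrep v])
  \<comment> \<open>Generalized to vectors whose paths end in a given set \<open>S\<close> of arrows
    into \<open>v\<close>, so that induction on \<open>S\<close> can remove one last arrow at a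
    time.\<close>
  have *: "f x = g x"
    if "finite S" "S \<subseteq> arrows_into Q v" "x \<in> carrier (rep_space ?V v)"
      "\<And>s p. s \<in> ?I \<Longrightarrow> x s p \<noteq> \<zero>\<^bsub>K\<^esub> \<Longrightarrow> p \<noteq> [] \<and> last p \<in> S" for S x
    using that
  proof (induction S arbitrary: x)
    case empty
    then have "x = \<zero>\<^bsub>rep_space ?V v\<^esub>"
      by (intro proj_sum_eqI[of _ Q d]) (auto simp: proj_sum_simps PiE_iff)
    then show ?case using module_hom_zero[OF V N f] module_hom_zero[OF V N g] by simp
  next
    case (insert \<alpha> S)
    have \<alpha>: "\<alpha> \<in> arcs Q" "head Q \<alpha> = v" "\<alpha> \<in> arrows_into Q v"
      using insert.prems(1) by (auto simp: arrows_into_def)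
    \<comment> \<open>\<open>x\<close> is split into the terms ending in \<alpha>, which form the
      image of \<open>y\<close> under \<alpha>, and the rest \<open>z\<close>, whose terms end in
      \<open>S\<close>.\<close>
    define y where "y = arrow_part Q d \<alpha> x"
    define z where "z = (\<lambda>s\<in>?I. \<lambda>p. if p \<noteq> [] \<and> last p = \<alpha> then \<zero>\<^bsub>K\<^esub> else x s p)"
    note xD = proj_sum_memD[OF insert.prems(2)]
    have y: "y \<in> carrier (rep_space ?V (tail Q \<alpha>))"
      unfolding y_def using insert.prems(2) \<alpha>
      by (auto intro: module_hom_mem[OF arrow_part_hom[OF wf_digraph]])
    have z: "z \<in> carrier (rep_space ?V v)"
    proof (rule proj_sum_memI)
      fix s p assume "s \<in> ?I" "z s p \<noteq> \<zero>\<^bsub>K\<^esub>"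
      then show "p \<in> quiver_paths Q (fst s) v"
        using xD(2)[of s p] by (auto simp: z_def split: if_splits)
    next
      fix s assume s: "s \<in> ?I"
      have "{p. z s p \<noteq> \<zero>\<^bsub>K\<^esub>} \<subseteq> {p. x s p \<noteq> \<zero>\<^bsub>K\<^esub>}" using s by (auto simp: z_def)
      then show "finite {p. z s p \<noteq> \<zero>\<^bsub>K\<^esub>}" using xD(3)[OF s] by (rule finite_subset)
    qed (use xD(1) in \<open>auto simp: z_def\<close>)
    have sum: "x = rep_act ?V \<alpha> y \<oplus>\<^bsub>rep_space ?V v\<^esub> z"
    proof (rule proj_sum_eqI)
      fix s p assume "s \<in> ?I"
      then show "x s p = (rep_act ?V \<alpha> y \<oplus>\<^bsub>rep_space ?V v\<^esub> z) s p"
        using xD(1)[of s p] append_butlast_last_id[of p]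
        by (auto simp: proj_sum_simps y_def z_def arrow_part_def)
    qed (use proj_sum_ext[OF insert.prems(2)] in \<open>simp_all add: proj_sum_simps\<close>)
    have ay: "rep_act ?V \<alpha> y \<in> carrier (rep_space ?V v)"
      using is_quiver_rep_act_mem[OF Vrep \<alpha>(1) y] \<alpha>(2) by simp
    have "f z = g z"
    proof (rule insert.IH[OF _ z])
      show "S \<subseteq> arrows_into Q v" using insert.prems(1) by simp
      fix s p assume "s \<in> ?I" "z s p \<noteq> \<zero>\<^bsub>K\<^esub>"
      then show "p \<noteq> [] \<and> last p \<in> S"
        using insert.prems(3)[of s p] by (auto simp: z_def split: if_splits)
    qed
    then show ?case
      using fg[OF \<alpha>(3) y] unfolding sum module_hom_add[OF f ay z] module_hom_add[OF g ay z] by simp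
  qed
  show ?thesis
  proof (rule *)
    show "finite (arrows_into Q v)" by (simp add: arrows_into_def)
    show "p \<noteq> [] \<and> last p \<in> arrows_into Q v" if "s \<in> ?I" "x s p \<noteq> \<zero>\<^bsub>K\<^esub>" for s p
      using path_to_removed_vertex[OF wf_digraph d that(1) proj_sum_memD(2)[OF x that]] by blast
  qed (use x in auto)
qed

lemma proj_sum_hom_extend:
  assumes Q: "fin_digraph Q" and K: "field K"
    and g: "\<And>\<alpha>. \<alpha> \<in> arrows_into Q v \<Longrightarrow>
      g (tail Q \<alpha>) \<in> module_hom K (proj_sum_space K Q d (tail Q \<alpha>)) (proj_sum_space K Q d (tail Q \<alpha>))"
  obtains T where "T \<in> module_hom K (proj_sum_space K Q d v) (proj_sum_space K Q d v)"
    and "\<And>\<alpha> y. \<alpha> \<in> arrows_into Q v \<Longrightarrow> y \<in> carrier (proj_sum_space K Q d (tail Q \<alpha>)) \<Longrightarrow>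
      T (rep_act (proj_sum K Q d) \<alpha> y) = rep_act (proj_sum K Q d) \<alpha> (g (tail Q \<alpha>) y)"
proof -
  interpret fin_digraph Q by fact
  interpret K: field K by fact
  let ?V = "proj_sum K Q d" and ?I = "proj_index Q d"
  have Vrep: "is_quiver_rep K Q ?V" by (rule is_quiver_rep_proj_sum[OF wf_digraph K])
  \<comment> \<open>The \<alpha>-part of \<open>x\<close>, stripped of \<alpha> and then moved by
    the given map at the source of \<alpha>.\<close>
  define c where "c \<alpha> x = g (tail Q \<alpha>) (arrow_part Q d \<alpha> x)" for \<alpha> x
  have c: "c \<alpha> \<in> module_hom K (rep_space ?V v) (rep_space ?V (tail Q \<alpha>))"
    if "\<alpha> \<in> arrows_into Q v" for \<alpha>
    unfolding c_def using that arrow_part_hom[OF wf_digraph, of \<alpha>]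
    by (intro module_hom_comp[OF _ g[OF that]]) (auto simp: arrows_into_def)
  \<comment> \<open>\<open>T\<close> attaches \<alpha> again to each \<open>c \<alpha> x\<close> and
    adds up. Since the last arrow of \<open>p\<close> singles out one term, no sum has to be
    written; the constant path gets coefficient zero.\<close>
  define T where "T x = (\<lambda>s\<in>?I. \<lambda>p. if p \<noteq> [] \<and> last p \<in> arrows_into Q v
    then c (last p) x s (butlast p) else \<zero>\<^bsub>K\<^esub>)" for x
  have "T \<in> module_hom K (rep_space ?V v) (rep_space ?V v)"
  proof (rule module_homI)
    fix x assume x: "x \<in> carrier (rep_space ?V v)"
    note cD = proj_sum_memD[OF module_hom_mem[OF c x]]
    show "T x \<in> carrier (rep_space ?V v)"
    proof (rule proj_sum_memI)
      fix s p assume s: "s \<in> ?I" and "T x s p \<noteq> \<zero>\<^bsub>K\<^esub>"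
      then have p: "p = butlast p @ [last p]" and l: "last p \<in> arrows_into Q v"
        and nz: "c (last p) x s (butlast p) \<noteq> \<zero>\<^bsub>K\<^esub>"
        by (auto simp: T_def split: if_splits)
      have "butlast p @ [last p] \<in> quiver_paths Q (fst s) v"
        unfolding quiver_paths_snoc[OF wf_digraph] using cD(2)[OF l s nz] l
        by (simp add: arrows_into_def)
      with p show "p \<in> quiver_paths Q (fst s) v" by simp
    next
      fix s assume s: "s \<in> ?I"
      let ?U = "\<Union>\<alpha>\<in>arrows_into Q v. (\<lambda>p. p @ [\<alpha>]) ` {p. c \<alpha> x s p \<noteq> \<zero>\<^bsub>K\<^esub>}"
      have "finite ?U"
        using cD(3)[OF _ s] by (auto simp: arrows_into_def)
      moreover have "{p. T x s p \<noteq> \<zero>\<^bsub>K\<^esub>} \<subseteq> ?U"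
      proof
        fix p assume "p \<in> {p. T x s p \<noteq> \<zero>\<^bsub>K\<^esub>}"
        with s have "p = butlast p @ [last p]" "last p \<in> arrows_into Q v"
          "c (last p) x s (butlast p) \<noteq> \<zero>\<^bsub>K\<^esub>"
          by (auto simp: T_def split: if_splits)
        then show "p \<in> ?U" by blast
      qed
      ultimately show "finite {p. T x s p \<noteq> \<zero>\<^bsub>K\<^esub>}" by (rule finite_subset[rotated])
    qed (use cD(1) in \<open>auto simp: T_def\<close>)
  next
    fix x y assume xy: "x \<in> carrier (rep_space ?V v)" "y \<in> carrier (rep_space ?V v)"
    have "c \<alpha> (x \<oplus>\<^bsub>rep_space ?V v\<^esub> y) s p = c \<alpha> x s p \<oplus>\<^bsub>K\<^esub> c \<alpha> y s p"
      if "\<alpha> \<in> arrows_into Q v" "s \<in> ?I" for \<alpha> s p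
      unfolding module_hom_add[OF c[OF that(1)] xy] using that(2) by (simp add: proj_sum_simps)
    then show "T (x \<oplus>\<^bsub>rep_space ?V v\<^esub> y) = T x \<oplus>\<^bsub>rep_space ?V v\<^esub> T y"
      unfolding proj_sum_simps(3)[where x = "T x" and y = "T y"] by (auto simp: T_def fun_eq_iff)
  next
    fix r x assume rx: "r \<in> carrier K" "x \<in> carrier (rep_space ?V v)"
    have "c \<alpha> (r \<odot>\<^bsub>rep_space ?V v\<^esub> x) s p = r \<otimes>\<^bsub>K\<^esub> c \<alpha> x s p"
      if "\<alpha> \<in> arrows_into Q v" "s \<in> ?I" for \<alpha> s p
      unfolding module_hom_smult[OF c[OF that(1)] rx] using that(2) by (simp add: proj_sum_simps)
    then show "T (r \<odot>\<^bsub>rep_space ?V v\<^esub> x) = r \<odot>\<^bsub>rep_space ?V v\<^esub> T x"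
      unfolding proj_sum_simps(4)[where x = "T x"] using rx(1) by (auto simp: T_def fun_eq_iff)
  qed
  moreover have "T (rep_act ?V \<alpha> y) = rep_act ?V \<alpha> (g (tail Q \<alpha>) y)"
    if \<alpha>: "\<alpha> \<in> arrows_into Q v" and y: "y \<in> carrier (rep_space ?V (tail Q \<alpha>))" for \<alpha> y
  proof (rule proj_sum_eqI)
    fix s p assume s: "s \<in> ?I"
    \<comment> \<open>For \<beta> other than \<alpha> the \<beta>-part of the image under \<alpha>
      is the zero vector. Linear maps kill it, so the term for \<alpha> alone survives in
      \<open>T\<close>.\<close>
    have zero: "g (tail Q \<beta>) (\<lambda>s\<in>?I. \<lambda>p. \<zero>\<^bsub>K\<^esub>) s q = \<zero>\<^bsub>K\<^esub>" if "\<beta> \<in> arrows_into Q v" for \<beta> q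
    proof -
      have "module K (rep_space ?V (tail Q \<beta>))"
        using that by (intro is_quiver_rep_space[OF Vrep]) (simp add: arrows_into_def)
      from module_hom_zero[OF this this g[OF that]] s show ?thesis by (simp add: proj_sum_simps)
    qed
    show "T (rep_act ?V \<alpha> y) s p = rep_act ?V \<alpha> (g (tail Q \<alpha>) y) s p"
      unfolding proj_sum_simps(5)[where x = "g (tail Q \<alpha>) y"] using s \<alpha> zero
      by (auto simp: T_def c_def arrow_part_act[OF proj_sum_ext[OF y]])
  qed (simp_all add: T_def proj_sum_simps)
  ultimately show ?thesis by (rule that)
qed


section \<open>Removing a vertex\<close>

lemma remove_vertex_simps:
  "verts (remove_vertex Q v) = verts Q - {v}"
  "tail (remove_vertex Q v) p = tail Q (hd p)"
  "head (remove_vertex Q v) p = head Q (last p)"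
  by (simp_all add: remove_vertex_def)

text \<open>The set difference deletes words of length one, so all words of length two through
  \<open>v\<close> survive.\<close>

lemma arcs_remove_vertex:
  "p \<in> arcs (remove_vertex Q v) \<longleftrightarrow>
    (\<exists>\<gamma>\<in>arcs Q. tail Q \<gamma> \<noteq> v \<and> head Q \<gamma> \<noteq> v \<and> p = [\<gamma>]) \<or>
    (\<exists>\<alpha>\<in>arrows_into Q v. \<exists>\<beta>\<in>arrows_from Q v. p = [\<alpha>, \<beta>])"
  by (auto simp: remove_vertex_def arrows_into_def arrows_from_def)

lemma arcs_remove_vertexE:
  assumes "p \<in> arcs (remove_vertex Q v)"
  obtains \<gamma> where "p = [\<gamma>]" "\<gamma> \<in> arcs Q" "tail Q \<gamma> \<noteq> v" "head Q \<gamma> \<noteq> v"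
  | \<alpha> \<beta> where "p = [\<alpha>, \<beta>]" "\<alpha> \<in> arcs Q" "head Q \<alpha> = v" "\<beta> \<in> arcs Q" "tail Q \<beta> = v"
  using assms unfolding arcs_remove_vertex by (auto simp: arrows_into_def arrows_from_def)

text \<open>A loop is a cycle of length one. This is the form in which acyclicity enters the
  comparison of paths.\<close>

lemma acyclic_quiver_no_loop:
  assumes "wf_digraph Q" "acyclic_quiver Q" "\<alpha> \<in> arcs Q"
  shows "tail Q \<alpha> \<noteq> head Q \<alpha>"
proof
  interpret wf_digraph Q by fact
  assume "tail Q \<alpha> = head Q \<alpha>"
  then have "cycle [\<alpha>]"
    using assms(3) by (auto simp: cycle_def awalk_simps)
  then show False using assms(2) by (auto simp: acyclic_quiver_def)
qed

text \<open>The vertex \<open>v\<close> contributes no index, so the two direct sums have literally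
  the same index set and vectors can be compared summand by summand.\<close>

lemma proj_index_remove_vertex:
  "d v = 0 \<Longrightarrow> proj_index (remove_vertex Q v) (restrict d (verts Q - {v})) = proj_index Q d"
  by (auto simp: proj_index_def remove_vertex_simps)

section \<open>Factoring paths into arrows of the new quiver\<close>

context
  fixes Q :: "('v, 'a) pre_digraph" and v :: 'v
  assumes Q: "fin_digraph Q" and no_loop: "\<And>\<alpha>. \<alpha> \<in> arcs Q \<Longrightarrow> tail Q \<alpha> \<noteq> head Q \<alpha>"
begin

interpretation fin_digraph Q by (fact Q)

text \<open>In a word \<alpha>\<beta> through \<open>v\<close>, the source of \<alpha> and the
  target of \<beta> differ from \<open>v\<close> because neither arrow is a loop.\<close>

lemma wf_remove_vertex: "wf_digraph (remove_vertex Q v)"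
proof
  fix p assume "p \<in> arcs (remove_vertex Q v)"
  then show "tail (remove_vertex Q v) p \<in> verts (remove_vertex Q v)"
    and "head (remove_vertex Q v) p \<in> verts (remove_vertex Q v)"
    by (cases rule: arcs_remove_vertexE; use no_loop in \<open>force simp: remove_vertex_simps\<close>)+
qed

interpretation R: wf_digraph "remove_vertex Q v" by (rule wf_remove_vertex)

text \<open>
  Paths of \<open>remove_vertex Q v\<close> are decoded uniquely because its arrows form a prefix code: an
  arrow of \<open>Q\<close> ending at \<open>v\<close> occurs only as the first letter of a word of length two.
\<close>

lemma inj_on_concat_remove_vertex: "inj_on concat (lists (arcs (remove_vertex Q v)))"
proof (rule inj_onI)
  let ?A = "arcs (remove_vertex Q v)"
  show "xs = ys" if "xs \<in> lists ?A" "ys \<in> lists ?A" "concat xs = concat ys" for xs ys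
    using that
  proof (induction xs arbitrary: ys rule: list.induct)
    case Nil
    then show ?case by (cases ys) (auto elim: arcs_remove_vertexE)
  next
    case (Cons a xs)
    have a: "a \<in> ?A" using Cons.prems(1) by simp
    then obtain b zs where ys: "ys = b # zs"
      using Cons.prems(3) by (cases ys) (auto elim: arcs_remove_vertexE)
    have b: "b \<in> ?A" using Cons.prems(2) ys by simp
    have "a = b"
      using a b Cons.prems(3) ys
      by (elim arcs_remove_vertexE) auto
    then show ?case using Cons ys by auto
  qed
qed

lemma concat_quiver_path:
  "q \<in> quiver_paths (remove_vertex Q v) i j \<Longrightarrow> concat q \<in> quiver_paths Q i j"
proof (induction q arbitrary: i)
  case Nil
  then show ?case by (auto simp: quiver_paths_Nil remove_vertex_simps)
next
  case (Cons a q)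
  from Cons.prems have "a \<in> arcs (remove_vertex Q v)" "i = tail Q (hd a)"
    "q \<in> quiver_paths (remove_vertex Q v) (head Q (last a)) j"
    by (auto simp: quiver_paths_def R.awalk_Cons_iff remove_vertex_simps)
  with Cons.IH[OF this(3)] show ?case
    by (elim arcs_remove_vertexE) (auto simp: quiver_paths_def awalk_Cons_iff)
qed

text \<open>The condition on \<open>i\<close> matters for the empty word, whose base point must be a
  vertex of the new quiver. It persists along the induction because every new arrow ends away from
  \<open>v\<close>.\<close>

lemma quiver_path_of_concat:
  "q \<in> lists (arcs (remove_vertex Q v)) \<Longrightarrow> concat q \<in> quiver_paths Q i j \<Longrightarrow> i \<noteq> v \<Longrightarrow>
   q \<in> quiver_paths (remove_vertex Q v) i j"
proof (induction q arbitrary: i)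
  case Nil
  then show ?case by (auto simp: quiver_paths_Nil remove_vertex_simps)
next
  case (Cons a q)
  have a: "a \<in> arcs (remove_vertex Q v)" and q: "q \<in> lists (arcs (remove_vertex Q v))"
    using Cons.prems(1) by auto
  from a have "i = tail Q (hd a) \<and> concat q \<in> quiver_paths Q (head Q (last a)) j \<and> head Q (last a) \<noteq> v"
    using Cons.prems(2) no_loop
    by (elim arcs_remove_vertexE) (force simp: quiver_paths_def awalk_Cons_iff)+
  with Cons.IH[OF q] a show ?case
    by (auto simp: quiver_paths_def R.awalk_Cons_iff remove_vertex_simps)
qed

text \<open>Reading from the left, an arrow that does not end at \<open>v\<close> is a word by
  itself, and one that ends at \<open>v\<close> is joined to its successor.\<close>

lemma quiver_path_decode:
  assumes "p \<in> quiver_paths Q i j" "i \<noteq> v" "j \<noteq> v"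
  obtains q where "q \<in> quiver_paths (remove_vertex Q v) i j" "concat q = p"
proof -
  have "\<exists>q\<in>lists (arcs (remove_vertex Q v)). concat q = p"
    using assms
  \<comment> \<open>Induction on the length, because one or two arrows are consumed at a
    time.\<close>
  proof (induction "length p" arbitrary: p i rule: less_induct)
    case less
    show ?case
    proof (cases p)
      case Nil
      then show ?thesis by (intro bexI[of _ "[]"]) auto
    next
      case (Cons \<gamma> p')
      have \<gamma>: "\<gamma> \<in> arcs Q" "tail Q \<gamma> \<noteq> v" and p': "p' \<in> quiver_paths Q (head Q \<gamma>) j"
        using less.prems Cons by (auto simp: quiver_paths_def awalk_Cons_iff)
      show ?thesis
      proof (cases "head Q \<gamma> = v")
        case False
        then obtain q where "q \<in> lists (arcs (remove_vertex Q v))" "concat q = p'"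
          using less.hyps[OF _ p'] less.prems(3) Cons by auto
        with \<gamma> False Cons show ?thesis
          by (intro bexI[of _ "[\<gamma>] # q"]) (auto simp: arcs_remove_vertex)
      next
        \<comment> \<open>The remaining path leads from \<open>v\<close> to \<open>j\<close>, which
          is not \<open>v\<close>, so it has a first arrow \<beta>. As \<beta> is no loop, the rest
          starts away from \<open>v\<close> and the induction hypothesis applies.\<close>
        case True
        then obtain \<beta> p'' where p'': "p' = \<beta> # p''"
          using p' less.prems(3) by (cases p') (auto simp: quiver_paths_Nil)
        have \<beta>: "\<beta> \<in> arcs Q" "tail Q \<beta> = v" "head Q \<beta> \<noteq> v" and tl: "p'' \<in> quiver_paths Q (head Q \<beta>) j"
          using p' True no_loop[of \<beta>] p'' by (auto simp: quiver_paths_def awalk_Cons_iff)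
        obtain q where "q \<in> lists (arcs (remove_vertex Q v))" "concat q = p''"
          using less.hyps[OF _ tl \<beta>(3)] less.prems(3) Cons p'' by auto
        with \<gamma> \<beta> True Cons p'' show ?thesis
          by (intro bexI[of _ "[\<gamma>, \<beta>] # q"])
            (auto simp: arcs_remove_vertex arrows_into_def arrows_from_def)
      qed
    qed
  qed
  with assms that show ?thesis by (auto intro: quiver_path_of_concat)
qed

end


section \<open>Comparison of the projective representations\<close>

text \<open>Coefficients are pulled back along \<open>concat\<close>. The zero default confines this
  to words over the new arrows, since \<open>concat\<close> is not injective on arbitrary lists:
  inserting an empty list does not change the value.\<close>

definition decode_vec ::
    "('k, 'x) ring_scheme \<Rightarrow> ('v, 'a) pre_digraph \<Rightarrow> 'v \<Rightarrow> ('v \<Rightarrow> nat) \<Rightarrow>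
     ('v \<times> nat \<Rightarrow> 'a list \<Rightarrow> 'k) \<Rightarrow> 'v \<times> nat \<Rightarrow> 'a list list \<Rightarrow> 'k" where
  "decode_vec K Q v d x = (\<lambda>s\<in>proj_index Q d. \<lambda>q.
    if q \<in> lists (arcs (remove_vertex Q v)) then x s (concat q) else \<zero>\<^bsub>K\<^esub>)"

context
  fixes K :: "('k, 'x) ring_scheme" and Q :: "('v, 'a) pre_digraph" and v :: 'v
    and d :: "'v \<Rightarrow> nat"
  assumes K: "field K" and Q: "fin_digraph Q"
    and no_loop: "\<And>\<alpha>. \<alpha> \<in> arcs Q \<Longrightarrow> tail Q \<alpha> \<noteq> head Q \<alpha>" and d: "d v = 0"
begin

interpretation field K by (fact K)
interpretation fin_digraph Q by (fact Q)

abbreviation (input) "dR \<equiv> restrict d (verts Q - {v})"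
abbreviation (input) "R \<equiv> remove_vertex Q v"

lemma index_R: "proj_index R dR = proj_index Q d"
  using d by (rule proj_index_remove_vertex)

lemma fst_proj_index: "s \<in> proj_index Q d \<Longrightarrow> fst s \<noteq> v"
  using d by (auto simp: proj_index_def)

lemma decode_vec_hom:
  "decode_vec K Q v d \<in> module_hom K (proj_sum_space K Q d j) (proj_sum_space K R dR j)"
proof (rule module_homI)
  fix x assume x: "x \<in> carrier (proj_sum_space K Q d j)"
  show "decode_vec K Q v d x \<in> carrier (proj_sum_space K R dR j)"
  proof (rule proj_sum_memI, unfold index_R)
    fix s q assume s: "s \<in> proj_index Q d" and "decode_vec K Q v d x s q \<noteq> \<zero>\<^bsub>K\<^esub>"
    then have "q \<in> lists (arcs R)" "x s (concat q) \<noteq> \<zero>\<^bsub>K\<^esub>"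
      by (auto simp: decode_vec_def split: if_splits)
    then show "q \<in> quiver_paths R (fst s) j"
      using proj_sum_memD(2)[OF x s] fst_proj_index[OF s]
      by (intro quiver_path_of_concat[OF Q no_loop]) auto
  next
    fix s assume s: "s \<in> proj_index Q d"
    \<comment> \<open>Unique decoding makes the preimage of the finite support finite.\<close>
    have "finite (concat -` {p. x s p \<noteq> \<zero>\<^bsub>K\<^esub>} \<inter> lists (arcs R))"
      using proj_sum_memD(3)[OF x s] inj_on_concat_remove_vertex[OF Q no_loop]
      by (rule finite_vimage_IntI)
    moreover have "{q. decode_vec K Q v d x s q \<noteq> \<zero>\<^bsub>K\<^esub>} =
        concat -` {p. x s p \<noteq> \<zero>\<^bsub>K\<^esub>} \<inter> lists (arcs R)"
      using s by (auto simp: decode_vec_def)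
    ultimately show "finite {q. decode_vec K Q v d x s q \<noteq> \<zero>\<^bsub>K\<^esub>}" by simp
  qed (use proj_sum_memD(1)[OF x] in \<open>auto simp: decode_vec_def\<close>)
qed (auto simp: decode_vec_def proj_sum_simps index_R fun_eq_iff)

text \<open>For \<open>j\<close> other than \<open>v\<close> every path from a summand's vertex to
  \<open>j\<close> has exactly one decoding, so coefficients on paths and on decoded paths determine
  each other.\<close>

lemma decode_vec_bij:
  assumes j: "j \<noteq> v"
  shows "bij_betw (decode_vec K Q v d) (carrier (proj_sum_space K Q d j))
    (carrier (proj_sum_space K R dR j))"
  unfolding bij_betw_def
proof
  show "inj_on (decode_vec K Q v d) (carrier (proj_sum_space K Q d j))"
  proof (rule inj_onI)
    fix x y assume x: "x \<in> carrier (proj_sum_space K Q d j)"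
      and y: "y \<in> carrier (proj_sum_space K Q d j)"
      and eq: "decode_vec K Q v d x = decode_vec K Q v d y"
    show "x = y"
    proof (rule proj_sum_eqI[OF proj_sum_ext[OF x] proj_sum_ext[OF y]])
      fix s p assume s: "s \<in> proj_index Q d"
      show "x s p = y s p"
      proof (cases "p \<in> quiver_paths Q (fst s) j")
        case True
        then obtain q where q: "q \<in> quiver_paths R (fst s) j" "concat q = p"
          using quiver_path_decode[OF Q no_loop _ fst_proj_index[OF s] j] by blast
        then have "q \<in> lists (arcs R)"
          by (auto simp: quiver_paths_def pre_digraph.awalk_def)
        with fun_cong[OF fun_cong[OF eq, of s], of q] s q(2) show ?thesis
          by (simp add: decode_vec_def)
      next
        case False
        then show ?thesis using proj_sum_memD(2)[OF x s] proj_sum_memD(2)[OF y s] by metis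
      qed
    qed
  qed
  show "decode_vec K Q v d ` carrier (proj_sum_space K Q d j) = carrier (proj_sum_space K R dR j)"
  proof
    show "decode_vec K Q v d ` carrier (proj_sum_space K Q d j) \<subseteq> carrier (proj_sum_space K R dR j)"
      using module_hom_mem[OF decode_vec_hom] by blast
    show "carrier (proj_sum_space K R dR j) \<subseteq> decode_vec K Q v d ` carrier (proj_sum_space K Q d j)"
    proof
      fix y assume y: "y \<in> carrier (proj_sum_space K R dR j)"
      note yD = proj_sum_memD[OF y, unfolded index_R]
      let ?L = "lists (arcs R)"
      note inj = inj_on_concat_remove_vertex[OF Q no_loop, of v]
      \<comment> \<open>The preimage transports the coefficients of \<open>y\<close> along the
        inverse of \<open>concat\<close>; lists without a decoding get zero.\<close>
      define x where "x = (\<lambda>s\<in>proj_index Q d. \<lambda>p.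
        if p \<in> concat ` ?L then y s (inv_into ?L concat p) else \<zero>\<^bsub>K\<^esub>)"
      have x: "x s (concat q) = y s q" if "s \<in> proj_index Q d" "q \<in> ?L" for s q
        using that by (simp add: x_def inv_into_f_f[OF inj])
      have nz: "\<exists>q. y s q \<noteq> \<zero>\<^bsub>K\<^esub> \<and> concat q = p" if "s \<in> proj_index Q d" "x s p \<noteq> \<zero>\<^bsub>K\<^esub>" for s p
      proof -
        from that obtain q where q: "q \<in> ?L" "p = concat q"
          by (auto simp: x_def split: if_splits)
        with that x show ?thesis by auto
      qed
      have "x \<in> carrier (proj_sum_space K Q d j)"
      proof (rule proj_sum_memI)
        fix s p assume s: "s \<in> proj_index Q d" and "x s p \<noteq> \<zero>\<^bsub>K\<^esub>"
        then obtain q where "y s q \<noteq> \<zero>\<^bsub>K\<^esub>" "concat q = p" using nz by blast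
        with yD(2)[OF s] show "p \<in> quiver_paths Q (fst s) j"
          using concat_quiver_path[OF Q no_loop] by blast
      next
        fix s assume s: "s \<in> proj_index Q d"
        have "{p. x s p \<noteq> \<zero>\<^bsub>K\<^esub>} \<subseteq> concat ` {q. y s q \<noteq> \<zero>\<^bsub>K\<^esub>}" using nz[OF s] by blast
        then show "finite {p. x s p \<noteq> \<zero>\<^bsub>K\<^esub>}" using yD(3)[OF s] by (meson finite_imageI finite_subset)
      qed (use yD(1) in \<open>auto simp: x_def\<close>)
      moreover have "decode_vec K Q v d x = y"
      proof (rule proj_sum_eqI)
        show "y \<in> extensional (proj_index Q d)" using proj_sum_ext[OF y] by (simp add: index_R)
        fix s q assume s: "s \<in> proj_index Q d"
        have "y s q = \<zero>\<^bsub>K\<^esub>" if "q \<notin> ?L"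
          using that yD(2)[OF s, of q] by (auto simp: quiver_paths_def pre_digraph.awalk_def)
        then show "decode_vec K Q v d x s q = y s q"
          using s x by (simp add: decode_vec_def)
      qed (simp add: decode_vec_def)
      ultimately show "y \<in> decode_vec K Q v d ` carrier (proj_sum_space K Q d j)" by blast
    qed
  qed
qed

text \<open>Everything depends on the last word of the new path. If its concatenation ends in
  \<gamma>, that word is \<open>[\<gamma>]\<close>: a word of length two ends in an arrow out of
  \<open>v\<close>, which \<gamma> is not.\<close>

lemma decode_vec_act_old:
  assumes \<gamma>: "\<gamma> \<in> arcs Q" "tail Q \<gamma> \<noteq> v" "head Q \<gamma> \<noteq> v"
  shows "decode_vec K Q v d (rep_act (proj_sum K Q d) \<gamma> x) =
    rep_act (proj_sum K R dR) [\<gamma>] (decode_vec K Q v d x)"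
proof (rule proj_sum_eqI)
  fix s q assume s: "s \<in> proj_index Q d"
  have \<gamma>': "[\<gamma>] \<in> arcs R" using \<gamma> by (simp add: arcs_remove_vertex)
  show "decode_vec K Q v d (rep_act (proj_sum K Q d) \<gamma> x) s q =
    rep_act (proj_sum K R dR) [\<gamma>] (decode_vec K Q v d x) s q"
  proof (cases q rule: rev_cases)
    case (snoc q' a)
    show ?thesis
    proof (cases "a \<in> arcs R")
      case True
      then show ?thesis
        by (cases rule: arcs_remove_vertexE)
          (use s \<gamma> snoc True in \<open>auto simp: decode_vec_def proj_sum_simps(5) index_R butlast_append\<close>)
    next
      case False
      with s \<gamma>' snoc show ?thesis by (auto simp: decode_vec_def proj_sum_simps(5) index_R)
    qed
  qed (use s in \<open>simp add: decode_vec_def proj_sum_simps(5) index_R\<close>)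
qed (simp_all add: decode_vec_def proj_sum_simps index_R)

text \<open>Conversely to the previous case, a path ending in \<beta> cannot have a last word of
  length one, because \<beta> starts at \<open>v\<close>; so the last word accounts for both
  \<alpha> and \<beta>.\<close>

lemma decode_vec_act_new:
  assumes \<alpha>: "\<alpha> \<in> arrows_into Q v" and \<beta>: "\<beta> \<in> arrows_from Q v"
  shows "decode_vec K Q v d (rep_act (proj_sum K Q d) \<beta> (rep_act (proj_sum K Q d) \<alpha> x)) =
    rep_act (proj_sum K R dR) [\<alpha>, \<beta>] (decode_vec K Q v d x)"
proof (rule proj_sum_eqI)
  fix s q assume s: "s \<in> proj_index Q d"
  have \<alpha>\<beta>: "[\<alpha>, \<beta>] \<in> arcs R" using \<alpha> \<beta> by (simp add: arcs_remove_vertex)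
  show "decode_vec K Q v d (rep_act (proj_sum K Q d) \<beta> (rep_act (proj_sum K Q d) \<alpha> x)) s q =
    rep_act (proj_sum K R dR) [\<alpha>, \<beta>] (decode_vec K Q v d x) s q"
  proof (cases q rule: rev_cases)
    case (snoc q' a)
    show ?thesis
    proof (cases "a \<in> arcs R")
      case True
      then show ?thesis
        by (cases rule: arcs_remove_vertexE)
          (use s \<beta> snoc True in \<open>auto simp: decode_vec_def proj_sum_simps(5) index_R butlast_append
            arrows_from_def\<close>)
    next
      case False
      with s \<alpha>\<beta> snoc show ?thesis by (auto simp: decode_vec_def proj_sum_simps(5) index_R)
    qed
  qed (use s in \<open>simp add: decode_vec_def proj_sum_simps(5) index_R\<close>)
qed (simp_all add: decode_vec_def proj_sum_simps index_R)

end


section \<open>The isomorphism of endomorphism algebras\<close>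

text \<open>
  Endomorphisms are restricted to the remaining vertices and conjugated with the isomorphisms
  \<open>\<phi> j\<close>.  The two hypotheses \<open>hom_eq\<close> and \<open>hom_extend\<close> express that \<open>V\<close> at \<open>v\<close> is the direct
  sum of the images of the arrows into \<open>v\<close>.
\<close>

definition transport_End ::
    "('v, 'a) pre_digraph \<Rightarrow> 'v \<Rightarrow> ('v, 'a, 'k, 'm) quiver_rep \<Rightarrow> ('v, 'b, 'k, 'n) quiver_rep \<Rightarrow>
     ('v \<Rightarrow> 'm \<Rightarrow> 'n) \<Rightarrow> ('v \<Rightarrow> 'm \<Rightarrow> 'm) \<Rightarrow> 'v \<Rightarrow> 'n \<Rightarrow> 'n" where
  "transport_End Q v V W \<phi> f = (\<lambda>j\<in>verts Q - {v}. \<lambda>y\<in>carrier (rep_space W j).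
    \<phi> j (f j (inv_into (carrier (rep_space V j)) (\<phi> j) y)))"

lemma transport_End_algebra_iso:
  fixes K :: "('k, 'x) ring_scheme" and Q :: "('v, 'a) pre_digraph" and v :: 'v
    and V :: "('v, 'a, 'k, 'm) quiver_rep" and W :: "('v, 'a list, 'k, 'n) quiver_rep"
  assumes Q: "fin_digraph Q" and v: "v \<in> verts Q"
    and no_loop: "\<And>\<alpha>. \<alpha> \<in> arcs Q \<Longrightarrow> tail Q \<alpha> \<noteq> head Q \<alpha>"
    and V: "is_quiver_rep K Q V" and W: "is_quiver_rep K (remove_vertex Q v) W"
    and \<phi>: "\<And>j. j \<in> verts Q \<Longrightarrow> j \<noteq> v \<Longrightarrow> \<phi> j \<in> module_hom K (rep_space V j) (rep_space W j)"
    and bij: "\<And>j. j \<in> verts Q \<Longrightarrow> j \<noteq> v \<Longrightarrow>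
      bij_betw (\<phi> j) (carrier (rep_space V j)) (carrier (rep_space W j))"
    and act_old: "\<And>\<gamma> x. \<gamma> \<in> arcs Q \<Longrightarrow> tail Q \<gamma> \<noteq> v \<Longrightarrow> head Q \<gamma> \<noteq> v \<Longrightarrow>
      x \<in> carrier (rep_space V (tail Q \<gamma>)) \<Longrightarrow>
      \<phi> (head Q \<gamma>) (rep_act V \<gamma> x) = rep_act W [\<gamma>] (\<phi> (tail Q \<gamma>) x)"
    and act_new: "\<And>\<alpha> \<beta> x. \<alpha> \<in> arrows_into Q v \<Longrightarrow> \<beta> \<in> arrows_from Q v \<Longrightarrow>
      x \<in> carrier (rep_space V (tail Q \<alpha>)) \<Longrightarrow>
      \<phi> (head Q \<beta>) (rep_act V \<beta> (rep_act V \<alpha> x)) = rep_act W [\<alpha>, \<beta>] (\<phi> (tail Q \<alpha>) x)"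
    and hom_eq: "\<And>j f g x. j \<in> verts Q \<Longrightarrow> f \<in> module_hom K (rep_space V v) (rep_space V j) \<Longrightarrow>
      g \<in> module_hom K (rep_space V v) (rep_space V j) \<Longrightarrow>
      (\<And>\<alpha> y. \<alpha> \<in> arrows_into Q v \<Longrightarrow> y \<in> carrier (rep_space V (tail Q \<alpha>)) \<Longrightarrow>
        f (rep_act V \<alpha> y) = g (rep_act V \<alpha> y)) \<Longrightarrow>
      x \<in> carrier (rep_space V v) \<Longrightarrow> f x = g x"
    and hom_extend: "\<And>g. (\<And>\<alpha>. \<alpha> \<in> arrows_into Q v \<Longrightarrow>
        g (tail Q \<alpha>) \<in> module_hom K (rep_space V (tail Q \<alpha>)) (rep_space V (tail Q \<alpha>))) \<Longrightarrow>
      \<exists>T \<in> module_hom K (rep_space V v) (rep_space V v).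
        \<forall>\<alpha>\<in>arrows_into Q v. \<forall>y\<in>carrier (rep_space V (tail Q \<alpha>)).
          T (rep_act V \<alpha> y) = rep_act V \<alpha> (g (tail Q \<alpha>) y)"
  shows "transport_End Q v V W \<phi> \<in> algebra_iso K (rep_End K Q V) (rep_End K (remove_vertex Q v) W)"
proof -
  interpret fin_digraph Q by fact
  let ?R = "remove_vertex Q v" and ?h = "transport_End Q v V W \<phi>"
  let ?A = "rep_End K Q V" and ?B = "rep_End K (remove_vertex Q v) W"
  have wfR: "wf_digraph ?R" by (rule wf_remove_vertex[OF Q no_loop])
  note actV = is_quiver_rep_act_mem[OF V]
  define \<psi> where "\<psi> j = inv_into (carrier (rep_space V j)) (\<phi> j)" for j
  have \<psi>_mem: "\<psi> j y \<in> carrier (rep_space V j)" and \<phi>\<psi>: "\<phi> j (\<psi> j y) = y"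
    if "j \<in> verts Q" "j \<noteq> v" "y \<in> carrier (rep_space W j)" for j y
    using that bij_betwE[OF bij_betw_inv_into[OF bij[OF that(1,2)]]]
      bij_betw_inv_into_right[OF bij[OF that(1,2)]] by (auto simp: \<psi>_def)
  have \<psi>\<phi>: "\<psi> j (\<phi> j x) = x" if "j \<in> verts Q" "j \<noteq> v" "x \<in> carrier (rep_space V j)" for j x
    using that bij_betw_inv_into_left[OF bij[OF that(1,2)]] by (auto simp: \<psi>_def)
  have \<phi>_mem: "\<phi> j x \<in> carrier (rep_space W j)"
    if "j \<in> verts Q" "j \<noteq> v" "x \<in> carrier (rep_space V j)" for j x
    using module_hom_mem[OF \<phi>] that by blast
  have \<psi>_hom: "\<psi> j \<in> module_hom K (rep_space W j) (rep_space V j)" if "j \<in> verts Q" "j \<noteq> v" for j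
    unfolding \<psi>_def
    using module_hom_inv_into[OF is_quiver_rep_space[OF V that(1)] \<phi>[OF that] bij[OF that]] .
  have h_eq: "?h f = (\<lambda>j\<in>verts ?R. \<lambda>y\<in>carrier (rep_space W j). \<phi> j (f j (\<psi> j y)))" for f
    by (simp add: transport_End_def \<psi>_def remove_vertex_simps)
  have h_apply: "?h f j y = \<phi> j (f j (\<psi> j y))"
    if "j \<in> verts Q" "j \<noteq> v" "y \<in> carrier (rep_space W j)" for f j y
    using that by (simp add: transport_End_def \<psi>_def)
  have into: "\<alpha> \<in> arcs Q" "head Q \<alpha> = v" "tail Q \<alpha> \<in> verts Q" "tail Q \<alpha> \<noteq> v"
    if "\<alpha> \<in> arrows_into Q v" for \<alpha>
    using that no_loop[of \<alpha>] by (auto simp: arrows_into_def)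
  have from_v: "\<beta> \<in> arcs Q" "tail Q \<beta> = v" "head Q \<beta> \<in> verts Q" "head Q \<beta> \<noteq> v"
    if "\<beta> \<in> arrows_from Q v" for \<beta>
    using that no_loop[of \<beta>] by (auto simp: arrows_from_def)
  have act_into: "rep_act V \<alpha> x \<in> carrier (rep_space V v)"
    if "\<alpha> \<in> arrows_into Q v" "x \<in> carrier (rep_space V (tail Q \<alpha>))" for \<alpha> x
    using actV[OF into(1)[OF that(1)] that(2)] into(2)[OF that(1)] by simp
  have act_from: "rep_act V \<beta> x \<in> carrier (rep_space V (head Q \<beta>))"
    if "\<beta> \<in> arrows_from Q v" "x \<in> carrier (rep_space V v)" for \<beta> x
    using actV[OF from_v(1)[OF that(1)]] from_v(2)[OF that(1)] that(2) by simp

  have h_mem: "?h f \<in> rep_hom K ?R W W" if f: "f \<in> rep_hom K Q V V" for f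
    unfolding h_eq
  proof (rule rep_hom_restrictI[OF wfR W])
    fix j assume "j \<in> verts ?R"
    then have j: "j \<in> verts Q" "j \<noteq> v" by (auto simp: remove_vertex_simps)
    show "(\<lambda>y. \<phi> j (f j (\<psi> j y))) \<in> module_hom K (rep_space W j) (rep_space W j)"
      using module_hom_comp[OF module_hom_comp[OF \<psi>_hom[OF j] rep_hom_component[OF f j(1)]] \<phi>[OF j]] .
  next
    fix p y assume p: "p \<in> arcs ?R" and y: "y \<in> carrier (rep_space W (tail ?R p))"
    from p show "\<phi> (head ?R p) (f (head ?R p) (\<psi> (head ?R p) (rep_act W p y))) =
      rep_act W p (\<phi> (tail ?R p) (f (tail ?R p) (\<psi> (tail ?R p) y)))"
    proof (cases rule: arcs_remove_vertexE)
      case (1 \<gamma>)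
      let ?i = "tail Q \<gamma>" and ?j = "head Q \<gamma>"
      have ij: "?i \<in> verts Q" "?j \<in> verts Q" using 1 by auto
      have y': "y \<in> carrier (rep_space W ?i)" using y 1 by (simp add: remove_vertex_simps)
      \<comment> \<open>Writing \<open>y\<close> as the image of \<open>x\<close> moves the
        naturality check to \<open>V\<close>, where \<open>f\<close> is known to be natural.\<close>
      define x where "x = \<psi> ?i y"
      have x: "x \<in> carrier (rep_space V ?i)" "\<phi> ?i x = y"
        unfolding x_def using \<psi>_mem[OF ij(1) 1(3) y'] \<phi>\<psi>[OF ij(1) 1(3) y'] by auto
      have "rep_act W p y = \<phi> ?j (rep_act V \<gamma> x)"
        using act_old[OF 1(2,3,4) x(1)] x(2) 1(1) by simp
      then have "\<psi> ?j (rep_act W p y) = rep_act V \<gamma> x"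
        using \<psi>\<phi>[OF ij(2) 1(4) actV[OF 1(2) x(1)]] by simp
      moreover have "f ?j (rep_act V \<gamma> x) = rep_act V \<gamma> (f ?i x)"
        by (rule rep_hom_natural[OF f 1(2) x(1)])
      moreover have "\<phi> ?j (rep_act V \<gamma> (f ?i x)) = rep_act W p (\<phi> ?i (f ?i x))"
        using act_old[OF 1(2,3,4) rep_hom_mem[OF f ij(1) x(1)]] 1(1) by simp
      ultimately show ?thesis
        using 1(1) by (simp add: remove_vertex_simps x_def)
    next
      case (2 \<alpha> \<beta>)
      have \<alpha>: "\<alpha> \<in> arrows_into Q v" and \<beta>: "\<beta> \<in> arrows_from Q v"
        using 2 by (auto simp: arrows_into_def arrows_from_def)
      let ?i = "tail Q \<alpha>" and ?j = "head Q \<beta>"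
      have y': "y \<in> carrier (rep_space W ?i)" using y 2 by (simp add: remove_vertex_simps)
      define x where "x = \<psi> ?i y"
      have x: "x \<in> carrier (rep_space V ?i)" "\<phi> ?i x = y"
        unfolding x_def using \<psi>_mem[OF into(3,4)[OF \<alpha>] y'] \<phi>\<psi>[OF into(3,4)[OF \<alpha>] y'] by auto
      have "rep_act W p y = \<phi> ?j (rep_act V \<beta> (rep_act V \<alpha> x))"
        using act_new[OF \<alpha> \<beta> x(1)] x(2) 2(1) by simp
      then have "\<psi> ?j (rep_act W p y) = rep_act V \<beta> (rep_act V \<alpha> x)"
        using \<psi>\<phi>[OF from_v(3,4)[OF \<beta>] act_from[OF \<beta> act_into[OF \<alpha> x(1)]]] by simp
      \<comment> \<open>Naturality is used twice, across \<alpha> into \<open>v\<close> and across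
        \<beta> out of \<open>v\<close>; the component of \<open>f\<close> at \<open>v\<close> drops
        out.\<close>
      moreover have "f ?j (rep_act V \<beta> (rep_act V \<alpha> x)) = rep_act V \<beta> (rep_act V \<alpha> (f ?i x))"
        using rep_hom_natural[OF f 2(2) x(1)] rep_hom_natural[OF f 2(4)] act_into[OF \<alpha> x(1)] 2
        by simp
      moreover have "\<phi> ?j (rep_act V \<beta> (rep_act V \<alpha> (f ?i x))) = rep_act W p (\<phi> ?i (f ?i x))"
        using act_new[OF \<alpha> \<beta> rep_hom_mem[OF f into(3)[OF \<alpha>] x(1)]] 2(1) by simp
      ultimately show ?thesis
        using 2(1) by (simp add: remove_vertex_simps x_def)
    qed
  qed

  have h_inj: "inj_on ?h (rep_hom K Q V V)"
  proof (rule inj_onI)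
    fix f g assume f: "f \<in> rep_hom K Q V V" and g: "g \<in> rep_hom K Q V V" and eq: "?h f = ?h g"
    have ne: "f j x = g j x" if j: "j \<in> verts Q" "j \<noteq> v" and x: "x \<in> carrier (rep_space V j)" for j x
    proof -
      have "\<phi> j (f j x) = \<phi> j (g j x)"
        using fun_cong[OF fun_cong[OF eq, of j], of "\<phi> j x"]
        by (simp add: h_apply[OF j \<phi>_mem[OF j x]] \<psi>\<phi>[OF j x])
      then show ?thesis
        using \<psi>\<phi>[OF j rep_hom_mem[OF f j(1) x]] \<psi>\<phi>[OF j rep_hom_mem[OF g j(1) x]] by metis
    qed
    show "f = g"
    proof (rule rep_hom_eqI[OF f g])
      fix j x assume j: "j \<in> verts Q" and x: "x \<in> carrier (rep_space V j)"
      show "f j x = g j x"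
      proof (cases "j = v")
        case True
        \<comment> \<open>Naturality carries the agreement at the sources of the arrows into
          \<open>v\<close> over to their images, and these determine a linear map on the space at
          \<open>v\<close>.\<close>
        have "f v (rep_act V \<alpha> y) = g v (rep_act V \<alpha> y)"
          if \<alpha>: "\<alpha> \<in> arrows_into Q v" and y: "y \<in> carrier (rep_space V (tail Q \<alpha>))" for \<alpha> y
          using rep_hom_natural[OF f into(1)[OF \<alpha>] y] rep_hom_natural[OF g into(1)[OF \<alpha>] y]
            ne[OF into(3,4)[OF \<alpha>] y] into(2)[OF \<alpha>] by simp
        from hom_eq[OF v rep_hom_component[OF f v] rep_hom_component[OF g v] this] x True
        show ?thesis by simp
      qed (use ne j x in blast)
    qed
  qed

  have h_surj: "\<exists>f\<in>rep_hom K Q V V. ?h f = g" if g: "g \<in> rep_hom K ?R W W" for g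
  proof -
    define e where "e j x = \<psi> j (g j (\<phi> j x))" for j x
    have e_hom: "e j \<in> module_hom K (rep_space V j) (rep_space V j)" if j: "j \<in> verts Q" "j \<noteq> v" for j
      unfolding e_def
      using module_hom_comp[OF module_hom_comp[OF \<phi>[OF j] rep_hom_component[OF g]] \<psi>_hom[OF j]] j
      by (simp add: remove_vertex_simps)
    have e_mem: "e j x \<in> carrier (rep_space V j)"
      if "j \<in> verts Q" "j \<noteq> v" "x \<in> carrier (rep_space V j)" for j x
      using module_hom_mem[OF e_hom] that by blast
    have g_mem: "g j y \<in> carrier (rep_space W j)"
      if "j \<in> verts Q" "j \<noteq> v" "y \<in> carrier (rep_space W j)" for j y
      using rep_hom_mem[OF g] that by (simp add: remove_vertex_simps)
    have \<phi>e: "\<phi> j (e j x) = g j (\<phi> j x)"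
      if "j \<in> verts Q" "j \<noteq> v" "x \<in> carrier (rep_space V j)" for j x
      unfolding e_def using that \<phi>\<psi> g_mem \<phi>_mem by simp
    have e_old: "e (head Q \<gamma>) (rep_act V \<gamma> x) = rep_act V \<gamma> (e (tail Q \<gamma>) x)"
      if \<gamma>: "\<gamma> \<in> arcs Q" "tail Q \<gamma> \<noteq> v" "head Q \<gamma> \<noteq> v"
        and x: "x \<in> carrier (rep_space V (tail Q \<gamma>))" for \<gamma> x
    proof -
      have ij: "tail Q \<gamma> \<in> verts Q" "head Q \<gamma> \<in> verts Q" using \<gamma> by auto
      have arc: "[\<gamma>] \<in> arcs ?R" using \<gamma> by (simp add: arcs_remove_vertex)
      have "g (head Q \<gamma>) (\<phi> (head Q \<gamma>) (rep_act V \<gamma> x)) =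
          rep_act W [\<gamma>] (g (tail Q \<gamma>) (\<phi> (tail Q \<gamma>) x))"
        using rep_hom_natural[OF g arc] \<phi>_mem[OF ij(1) \<gamma>(2) x]
        by (simp add: remove_vertex_simps act_old[OF \<gamma> x])
      also have "\<dots> = \<phi> (head Q \<gamma>) (rep_act V \<gamma> (e (tail Q \<gamma>) x))"
        by (simp add: act_old[OF \<gamma> e_mem[OF ij(1) \<gamma>(2) x]] \<phi>e[OF ij(1) \<gamma>(2) x])
      finally show ?thesis
        unfolding e_def[of "head Q \<gamma>"]
        using \<psi>\<phi>[OF ij(2) \<gamma>(3) actV[OF \<gamma>(1) e_mem[OF ij(1) \<gamma>(2) x]]] by simp
    qed
    have e_new: "e (head Q \<beta>) (rep_act V \<beta> (rep_act V \<alpha> x)) =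
        rep_act V \<beta> (rep_act V \<alpha> (e (tail Q \<alpha>) x))"
      if \<alpha>: "\<alpha> \<in> arrows_into Q v" and \<beta>: "\<beta> \<in> arrows_from Q v"
        and x: "x \<in> carrier (rep_space V (tail Q \<alpha>))" for \<alpha> \<beta> x
    proof -
      have arc: "[\<alpha>, \<beta>] \<in> arcs ?R" using \<alpha> \<beta> by (simp add: arcs_remove_vertex)
      have "g (head Q \<beta>) (\<phi> (head Q \<beta>) (rep_act V \<beta> (rep_act V \<alpha> x))) =
          rep_act W [\<alpha>, \<beta>] (g (tail Q \<alpha>) (\<phi> (tail Q \<alpha>) x))"
        using rep_hom_natural[OF g arc] \<phi>_mem[OF into(3,4)[OF \<alpha>] x]
        by (simp add: remove_vertex_simps act_new[OF \<alpha> \<beta> x])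
      also have "\<dots> = \<phi> (head Q \<beta>) (rep_act V \<beta> (rep_act V \<alpha> (e (tail Q \<alpha>) x)))"
        by (simp add: act_new[OF \<alpha> \<beta> e_mem[OF into(3,4)[OF \<alpha>] x]] \<phi>e[OF into(3,4)[OF \<alpha>] x])
      finally show ?thesis
        unfolding e_def[of "head Q \<beta>"]
        using \<psi>\<phi>[OF from_v(3,4)[OF \<beta>] act_from[OF \<beta> act_into[OF \<alpha> e_mem[OF into(3,4)[OF \<alpha>] x]]]]
        by simp
    qed
    \<comment> \<open>The arrows into \<open>v\<close> start away from \<open>v\<close>, where
      \<open>e\<close> is linear; the extension asks for no more.\<close>
    have "\<exists>T \<in> module_hom K (rep_space V v) (rep_space V v).
        \<forall>\<alpha>\<in>arrows_into Q v. \<forall>y\<in>carrier (rep_space V (tail Q \<alpha>)).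
          T (rep_act V \<alpha> y) = rep_act V \<alpha> (e (tail Q \<alpha>) y)"
      by (rule hom_extend) (rule e_hom, erule into, erule into)
    then obtain T where T: "T \<in> module_hom K (rep_space V v) (rep_space V v)"
      and T_act: "\<And>\<alpha> y. \<alpha> \<in> arrows_into Q v \<Longrightarrow> y \<in> carrier (rep_space V (tail Q \<alpha>)) \<Longrightarrow>
          T (rep_act V \<alpha> y) = rep_act V \<alpha> (e (tail Q \<alpha>) y)"
      by blast
    \<comment> \<open>Nothing is assumed about \<phi> at \<open>v\<close>, so \<open>e\<close>
      carries no information there and \<open>T\<close> takes its place.\<close>
    define e' where "e' j = (if j = v then T else e j)" for j
    define f where "f = (\<lambda>j\<in>verts Q. \<lambda>x\<in>carrier (rep_space V j). e' j x)"
    have f: "f \<in> rep_hom K Q V V"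
      unfolding f_def
    proof (rule rep_hom_restrictI[OF wf_digraph V])
      fix j assume "j \<in> verts Q"
      then show "e' j \<in> module_hom K (rep_space V j) (rep_space V j)"
        using T e_hom by (simp add: e'_def)
    next
      fix \<gamma> x assume \<gamma>: "\<gamma> \<in> arcs Q" and x: "x \<in> carrier (rep_space V (tail Q \<gamma>))"
      consider "tail Q \<gamma> \<noteq> v" "head Q \<gamma> \<noteq> v" | "\<gamma> \<in> arrows_into Q v" | "\<gamma> \<in> arrows_from Q v"
        using \<gamma> by (auto simp: arrows_into_def arrows_from_def)
      then show "e' (head Q \<gamma>) (rep_act V \<gamma> x) = rep_act V \<gamma> (e' (tail Q \<gamma>) x)"
      proof cases
        case 1
        then show ?thesis using e_old[OF \<gamma> _ _ x] by (simp add: e'_def)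
      next
        case 2
        then show ?thesis using T_act[OF 2 x] into[OF 2] by (simp add: e'_def)
      next
        case 3
        note \<beta> = from_v[OF 3]
        have hom: "rep_act V \<gamma> \<in> module_hom K (rep_space V v) (rep_space V (head Q \<gamma>))"
          using is_quiver_rep_act[OF V \<gamma>] \<beta>(2) by simp
        \<comment> \<open>\<open>T\<close> was constructed without regard to arrows leaving
          \<open>v\<close>. By \<open>hom_eq\<close> the equation is checked after each arrow
          \<alpha> into \<open>v\<close>, where it reads \<open>e_new\<close> and thus rests on the
          naturality of \<open>g\<close> at \<open>[\<alpha>, \<gamma>]\<close>.\<close>
        have "e (head Q \<gamma>) (rep_act V \<gamma> x) = rep_act V \<gamma> (T x)"
        proof (rule hom_eq[OF \<beta>(3) module_hom_comp[OF hom e_hom[OF \<beta>(3,4)]] module_hom_comp[OF T hom]])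
          fix \<alpha> y assume "\<alpha> \<in> arrows_into Q v" "y \<in> carrier (rep_space V (tail Q \<alpha>))"
          then show "e (head Q \<gamma>) (rep_act V \<gamma> (rep_act V \<alpha> y)) = rep_act V \<gamma> (T (rep_act V \<alpha> y))"
            using e_new 3 T_act by simp
        qed (use x \<beta>(2) in simp)
        then show ?thesis using \<beta> by (simp add: e'_def)
      qed
    qed
    have "?h f = g"
    proof (rule rep_hom_eqI[OF h_mem[OF f] g])
      fix j y assume "j \<in> verts ?R" and y: "y \<in> carrier (rep_space W j)"
      then have j: "j \<in> verts Q" "j \<noteq> v" by (auto simp: remove_vertex_simps)
      show "?h f j y = g j y"
        using j \<psi>_mem[OF j y] \<phi>e[OF j \<psi>_mem[OF j y]] \<phi>\<psi>[OF j y]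
        by (simp add: h_apply[OF j y] f_def e'_def)
    qed
    with f show ?thesis by blast
  qed

  have bij_h: "bij_betw ?h (carrier ?A) (carrier ?B)"
    unfolding rep_End_simps(1) bij_betw_def using h_inj h_mem h_surj by blast

  note closedV = rep_End_closed[OF wf_digraph V]
  note closedW = rep_End_closed[OF wfR W]
  note applyV = rep_End_apply[where K = K and Q = Q and V = V]
  note applyW = rep_End_apply[where K = K and Q = ?R and V = W]
  \<comment> \<open>Each law of an algebra homomorphism is reduced to an equation of vectors at the
    vertices other than \<open>v\<close>.\<close>
  have eqI: "?h f = g" if "f \<in> rep_hom K Q V V" "g \<in> rep_hom K ?R W W"
    and "\<And>j y. j \<in> verts Q \<Longrightarrow> j \<noteq> v \<Longrightarrow> y \<in> carrier (rep_space W j) \<Longrightarrow>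
      \<phi> j (f j (\<psi> j y)) = g j y" for f g
    by (rule rep_hom_eqI[OF h_mem[OF that(1)] that(2)])
      (use that(3) h_apply in \<open>simp add: remove_vertex_simps\<close>)
  have "?h \<in> ring_iso ?A ?B"
  proof (rule ring_iso_memI[OF _ _ _ _ bij_h], unfold rep_End_simps(1))
    show "?h \<one>\<^bsub>?A\<^esub> = \<one>\<^bsub>?B\<^esub>"
      by (rule eqI[OF closedV(2) closedW(2)])
        (simp add: applyV applyW remove_vertex_simps \<psi>_mem \<phi>\<psi>)
  next
    fix f g assume f: "f \<in> rep_hom K Q V V" and g: "g \<in> rep_hom K Q V V"
    show "?h (f \<otimes>\<^bsub>?A\<^esub> g) = ?h f \<otimes>\<^bsub>?B\<^esub> ?h g"
      by (rule eqI[OF closedV(1)[OF f g] closedW(1)[OF h_mem[OF f] h_mem[OF g]]])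
        (simp add: applyV applyW remove_vertex_simps \<psi>_mem h_apply \<phi>_mem \<psi>\<phi> rep_hom_mem[OF g])
    show "?h (f \<oplus>\<^bsub>?A\<^esub> g) = ?h f \<oplus>\<^bsub>?B\<^esub> ?h g"
      by (rule eqI[OF closedV(4)[OF f g] closedW(4)[OF h_mem[OF f] h_mem[OF g]]])
        (simp add: applyV applyW remove_vertex_simps \<psi>_mem h_apply rep_hom_mem[OF f]
          rep_hom_mem[OF g] module_hom_add[OF \<phi>])
  qed (rule h_mem)
  moreover have "?h \<in> module_hom K ?A ?B"
  proof (rule module_homI, unfold rep_End_simps(1))
    fix f g assume f: "f \<in> rep_hom K Q V V" and g: "g \<in> rep_hom K Q V V"
    show "?h (f \<oplus>\<^bsub>?A\<^esub> g) = ?h f \<oplus>\<^bsub>?B\<^esub> ?h g"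
      using ring_iso_memE(3)[OF \<open>?h \<in> ring_iso ?A ?B\<close>] f g by (simp add: rep_End_simps(1))
  next
    fix c f assume c: "c \<in> carrier K" and f: "f \<in> rep_hom K Q V V"
    show "?h (c \<odot>\<^bsub>?A\<^esub> f) = c \<odot>\<^bsub>?B\<^esub> ?h f"
      by (rule eqI[OF closedV(5)[OF f c] closedW(5)[OF h_mem[OF f] c]])
        (simp add: applyV applyW remove_vertex_simps \<psi>_mem h_apply rep_hom_mem[OF f]
          module_hom_smult[OF \<phi>] c)
  qed (rule h_mem)
  ultimately show ?thesis by (simp add: algebra_iso_def)
qed

theorem theorem3p10:
  fixes K :: "('k, 'x) ring_scheme" and Q :: "('v, 'a) pre_digraph"
    and d :: "'v \<Rightarrow> nat" and v :: 'v
  assumes "field K" and "finite (carrier K)"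
    and "fin_digraph Q" and "acyclic_quiver Q"
    and "v \<in> verts Q" and "d v = 0"
  shows "algebra_isomorphic K
           (proj_End K Q d)
           (proj_End K (remove_vertex Q v) (restrict d (verts Q - {v}))) \<and>
         commuting_count K Q d =
           commuting_count K (remove_vertex Q v) (restrict d (verts Q - {v}))"
proof -
  interpret field K by fact
  interpret fin_digraph Q by fact
  let ?R = "remove_vertex Q v" and ?dR = "restrict d (verts Q - {v})"
  have no_loop: "tail Q \<alpha> \<noteq> head Q \<alpha>" if "\<alpha> \<in> arcs Q" for \<alpha>
    using acyclic_quiver_no_loop[OF wf_digraph assms(4) that] .
  have wfR: "wf_digraph ?R" by (rule wf_remove_vertex[OF assms(3) no_loop])
  have V: "is_quiver_rep K Q (proj_sum K Q d)"
    by (rule is_quiver_rep_proj_sum[OF wf_digraph assms(1)])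
  have W: "is_quiver_rep K ?R (proj_sum K ?R ?dR)"
    by (rule is_quiver_rep_proj_sum[OF wfR assms(1)])
  \<comment> \<open>The comparison of vectors is given by the same formula at every vertex, hence
    the constant family.\<close>
  let ?h = "transport_End Q v (proj_sum K Q d) (proj_sum K ?R ?dR) (\<lambda>j. decode_vec K Q v d)"
  have h: "?h \<in> algebra_iso K (proj_End K Q d) (proj_End K ?R ?dR)"
    unfolding proj_End_def
  proof (rule transport_End_algebra_iso[OF assms(3,5) no_loop V W])
    show "f x = g x"
      if "j \<in> verts Q" "f \<in> module_hom K (proj_sum_space K Q d v) (proj_sum_space K Q d j)"
        "g \<in> module_hom K (proj_sum_space K Q d v) (proj_sum_space K Q d j)"
        "\<And>\<alpha> y. \<alpha> \<in> arrows_into Q v \<Longrightarrow> y \<in> carrier (proj_sum_space K Q d (tail Q \<alpha>)) \<Longrightarrow>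
          f (rep_act (proj_sum K Q d) \<alpha> y) = g (rep_act (proj_sum K Q d) \<alpha> y)"
        "x \<in> carrier (proj_sum_space K Q d v)" for j f g x
      using proj_sum_hom_eq[OF assms(3,1,6) is_quiver_rep_space[OF V that(1)] that(2-5) assms(5)] .
    show "\<exists>T \<in> module_hom K (proj_sum_space K Q d v) (proj_sum_space K Q d v).
        \<forall>\<alpha>\<in>arrows_into Q v. \<forall>y\<in>carrier (proj_sum_space K Q d (tail Q \<alpha>)).
          T (rep_act (proj_sum K Q d) \<alpha> y) = rep_act (proj_sum K Q d) \<alpha> (g (tail Q \<alpha>) y)"
      if "\<And>\<alpha>. \<alpha> \<in> arrows_into Q v \<Longrightarrow> g (tail Q \<alpha>) \<in>
        module_hom K (proj_sum_space K Q d (tail Q \<alpha>)) (proj_sum_space K Q d (tail Q \<alpha>))" for g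
      using proj_sum_hom_extend[OF assms(3,1) that] by metis
  qed (simp_all add: decode_vec_hom[where d = d and v = v, OF assms(1,3) no_loop assms(6)]
      decode_vec_bij[where d = d and v = v, OF assms(1,3) no_loop assms(6)]
      decode_vec_act_old[where d = d and v = v, OF assms(1,3) no_loop assms(6)]
      decode_vec_act_new[where d = d and v = v, OF assms(1,3) no_loop assms(6)])
  \<comment> \<open>The radical and commutation refer to the ring structure, so the ring part of the
    isomorphism carries the count across.\<close>
  then have "?h \<in> ring_iso (proj_End K Q d) (proj_End K ?R ?dR)" by (simp add: algebra_iso_def)
  moreover have "ring (proj_End K Q d)"
    unfolding proj_End_def by (rule ring_rep_End[OF wf_digraph V is_cring])
  moreover have "ring (proj_End K ?R ?dR)"
    unfolding proj_End_def by (rule ring_rep_End[OF wfR W is_cring])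
  ultimately have "commuting_count K Q d = commuting_count K ?R ?dR"
    unfolding commuting_count_def by (intro card_commuting_pairs_radical)
  with h show ?thesis by (auto simp: algebra_isomorphic_def)
qed

end
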